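(* Let $\mathsf P=(\mathsf G,\mathsf M,\mathsf W)$ be a secure network coding problem in which $|O(s)|=1$ for every $s\in\mathcal S$, and let $q$ be a prime power. A rate-capacity tuple $(\lambda,\omega)$ is $0$-achievable subject to $q$-linearity and strong secrecy if and only if \[(\lambda,\omega)\in\mathsf{CL}\big(\mathrm{proj}_{\mathsf P}[\bar\Upsilon^*_q\cap\mathcal C_I(\mathsf P)\cap\mathcal C_T(\mathsf P)\cap\mathcal C_D(\mathsf P)\cap\mathcal C_S(\mathsf P)]\big).\]
   Context: A network is $\mathsf G=(\mathcal V,\mathcal E)$, $\mathcal V$ a finite set of nodes, $\mathcal E$ a finite set of hyperedges, each $e$ with tail $\mathrm{tail}(e)\in\mathcal V$ and head $\mathrm{head}(e)\subseteq\mathcal V$, without directed cycles. A connection constraint $\mathsf M=(\mathcal S,O,D)$: finite source index set $\mathcal S$, $O:\mathcal S\to2^{\mathcal V}$ (where source $s$ is available), $D:\mathcal S\to2^{\mathcal V}$ (sinks of $s$). Sources are imaginary edges with $\mathrm{head}(s)=O(s)$; $\mathrm{in}(e)=\{f\in\mathcal S\cup\mathcal E:\mathrm{tail}(e)\in\mathrm{head}(f)\}$, $\mathrm{in}(u)=\{f\in\mathcal S\cup\mathcal E:u\in\mathrm{head}(f)\}$. A wiretapping pattern is $\mathsf W=\{(\mathcal A_r,\mathcal B_r):r\in\mathcal R\}$ with $\mathcal R$ finite, $\mathcal A_r\subseteq\mathcal S$, $\mathcal B_r\subseteq\mathcal E$ (adversary $r$ observes the links in $\mathcal B_r$ and targets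 the sources in $\mathcal A_r$). A secure network coding problem is $\mathsf P=(\mathsf G,\mathsf M,\mathsf W)$. The sets $\mathcal S,\mathcal E,\mathcal V$ are treated as disjoint index sets. For a finite set $\mathcal N$, $\mathcal H[\mathcal N]$ is the set of real functions on subsets of $\mathcal N$; $g(\alpha\mid\beta)=g(\alpha\cup\beta)-g(\beta)$, $g(\alpha\wedge\beta)=g(\alpha)+g(\beta)-g(\alpha\cup\beta)$. Define subsets of $\mathcal H[\mathcal S\cup\mathcal E\cup\mathcal V]$: $\mathcal C_I(\mathsf P)=\{h:h(\mathcal S\cup\mathcal V)=\sum_{s\in\mathcal S}h(s)+\sum_{u\in\mathcal V}h(u)\}$; $\mathcal C_T(\mathsf P)=\{h:h(e\mid\mathrm{in}(e)\cup\{\mathrm{tail}(e)\})=0\ \forall e\in\mathcal E\}$; $\mathcal C_D(\mathsf P)=\{h:h(s\mid\mathrm{in}(u))=0\ \forall s\in\mathcal S,u\in D(s)\}$; $\mathcal C_S(\mathsf P)=\{h:h(\mathcal A_r\wedge\mathcal B_r)=0\ \forall r\in\mathcal R\}$. A stochastic network code is a family of discrete random variables $\{Y_f:f\in\mathcal S\cup\mathcal E\cup\mathcal V\}$ with finite supports ($Y_u$, $u\in\mathcal V$, is a local random key at node $u$) such that each $Y_s$ is uniform on its alphabet and its entropy function $\alpha\mapsto H(Y_f,f\in\alpha)$ lies in $\mathcal C_I(\mathsf P)\cap\mathcal C_T(\mathsf P)$. It is $q$-linear if each $Y_f$, $f\in\mathcal S\cup\mathcal V$, is a row vector over $GF(q)$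 with entries independent and uniform over $GF(q)$, and for every $e\in\mathcal E$, $Y_e=\phi_e(Y_{\mathrm{in}(e)},Y_{\mathrm{tail}(e)})$ for a $GF(q)$-linear map $\phi_e$. $\mathrm{SP}(X)$ is the support of $X$. A rate-capacity tuple $(\lambda,\omega)$, $\lambda:\mathcal S\to\mathbb R_{\ge0}$, $\omega:\mathcal E\to\mathbb R_{\ge0}$, is $0$-achievable subject to $q$-linearity and strong secrecy if there exist $q$-linear stochastic network codes $\{Y^n_f\}$ and $c_n>0$ with (S1) $\lim_nc_n\log|\mathrm{SP}(Y^n_e)|\le\omega(e)$ and $\lim_nc_n\log|\mathrm{SP}(Y^n_s)|\ge\lambda(s)$ for all $e,s$; (S2) $H(Y^n_s\mid Y^n_f,f\in\mathrm{in}(u))=0$ for all $n$, $s$, $u\in D(s)$; (S3$'$) $I(Y^n_{\mathcal A_r};Y^n_{\mathcal B_r})=0$ for all $n$ and $r\in\mathcal R$. A function $h\in\mathcal H[\mathcal N]$ is $q$-representable if there are subspaces $\mathbb U_i$ ($i\in\mathcal N$) of a finite-dimensional $GF(q)$-vector space with $h(\alpha)=\dim\langle\mathbb U_i:i\in\alpha\rangle$; weakly $q$-representable if $ch$ is $q$-representable for some $c>0$; almost $q$-representable if a limit of weakly $q$-representable functions. $\bar\Upsilon^*_q$ is the set of almost $q$-representable functions in $\mathcal H[\mathcal S\cup\mathcal E\cup\mathcal V]$. $\mathrm{proj}_{\mathsf P}[h]=(h(s),s\in\mathcal S;h(e),e\in\mathcal E)$, applied elementwise to sets. For a set $\mathcal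 R'$ of tuples, $\mathsf{CL}(\mathcal R')$ is the set of $(\lambda,\omega)$ such that there exist $(\lambda^n,\omega^n)\in\mathcal R'$ and $c_n>0$ with $\lim_nc_n\omega^n(e)\le\omega(e)$ and $\lim_nc_n\lambda^n(s)\ge\lambda(s)$ for all $e,s$. *)

theory Defs
  imports "HOL-Probability.Probability_Mass_Function" "HOL-Library.Function_Algebras"
begin

text \<open>All indices (sources, links, nodes) live in one type 'n; the sets of sources,
links and nodes are pairwise disjoint finite subsets.  Sources are imaginary edges
with head(s) = O(s).  A wiretapping pattern is a finite set of pairs (A_r, B_r).\<close>

record 'n sncp =
  srcs  :: "'n set"
  lnks  :: "'n set"
  nods  :: "'n set"
  tl    :: "'n \<Rightarrow> 'n"
  hd    :: "'n \<Rightarrow> 'n set"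
  orig  :: "'n \<Rightarrow> 'n set"
  dest  :: "'n \<Rightarrow> 'n set"
  wtap  :: "('n set \<times> 'n set) set"

definition node_rel :: "'n sncp \<Rightarrow> ('n \<times> 'n) set" where
  "node_rel P = {(tl P e, v) | e v. e \<in> lnks P \<and> v \<in> hd P e}"

definition sec_problem :: "'n sncp \<Rightarrow> bool" where
  "sec_problem P \<longleftrightarrow>
     finite (srcs P) \<and> finite (lnks P) \<and> finite (nods P) \<and>
     srcs P \<inter> lnks P = {} \<and> srcs P \<inter> nods P = {} \<and> lnks P \<inter> nods P = {} \<and>
     (\<forall>e\<in>lnks P. tl P e \<in> nods P \<and> hd P e \<subseteq> nods P) \<and>
     acyclic (node_rel P) \<and>
     (\<forall>s\<in>srcs P. orig P s \<subseteq> nods P \<and> dest P s \<subseteq> nods P) \<and>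
     finite (wtap P) \<and> (\<forall>(A,B)\<in>wtap P. A \<subseteq> srcs P \<and> B \<subseteq> lnks P)"

definition idx :: "'n sncp \<Rightarrow> 'n set" where
  "idx P = srcs P \<union> lnks P \<union> nods P"

definition hd' :: "'n sncp \<Rightarrow> 'n \<Rightarrow> 'n set" where
  "hd' P f = (if f \<in> srcs P then orig P f else hd P f)"

definition in_edge :: "'n sncp \<Rightarrow> 'n \<Rightarrow> 'n set" where
  "in_edge P e = {f \<in> srcs P \<union> lnks P. tl P e \<in> hd' P f}"

definition in_node :: "'n sncp \<Rightarrow> 'n \<Rightarrow> 'n set" where
  "in_node P u = {f \<in> srcs P \<union> lnks P. u \<in> hd' P f}"

definition condh :: "('n set \<Rightarrow> real) \<Rightarrow> 'n set \<Rightarrow> 'n set \<Rightarrow> real" where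
  "condh h \<alpha> \<beta> = h (\<alpha> \<union> \<beta>) - h \<beta>"

definition meeth :: "('n set \<Rightarrow> real) \<Rightarrow> 'n set \<Rightarrow> 'n set \<Rightarrow> real" where
  "meeth h \<alpha> \<beta> = h \<alpha> + h \<beta> - h (\<alpha> \<union> \<beta>)"

definition C_I :: "'n sncp \<Rightarrow> ('n set \<Rightarrow> real) set" where
  "C_I P = {h. h (srcs P \<union> nods P) = (\<Sum>s\<in>srcs P. h {s}) + (\<Sum>u\<in>nods P. h {u})}"

definition C_T :: "'n sncp \<Rightarrow> ('n set \<Rightarrow> real) set" where
  "C_T P = {h. \<forall>e\<in>lnks P. condh h {e} (in_edge P e \<union> {tl P e}) = 0}"

definition C_D :: "'n sncp \<Rightarrow> ('n set \<Rightarrow> real) set" where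
  "C_D P = {h. \<forall>s\<in>srcs P. \<forall>u\<in>dest P s. condh h {s} (in_node P u) = 0}"

definition C_S :: "'n sncp \<Rightarrow> ('n set \<Rightarrow> real) set" where
  "C_S P = {h. \<forall>(A,B)\<in>wtap P. meeth h A B = 0}"

definition entropy_pmf :: "'a pmf \<Rightarrow> real" where
  "entropy_pmf p = - (\<Sum>x\<in>set_pmf p. pmf p x * log 2 (pmf p x))"

text \<open>A family of random variables (Y_f) with values in 'q list (row vectors over GF(q))
is represented by its joint distribution Pr over assignments y : 'n \<Rightarrow> 'q list.
The entropy function maps \<alpha> to H(Y_f, f \<in> \<alpha>).\<close>

definition ent_fun :: "('n \<Rightarrow> 'b list) pmf \<Rightarrow> 'n set \<Rightarrow> real" where
  "ent_fun Pr \<alpha> = entropy_pmf (map_pmf (\<lambda>y f. if f \<in> \<alpha> then y f else []) Pr)"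

definition rv :: "('n \<Rightarrow> 'b list) pmf \<Rightarrow> 'n \<Rightarrow> 'b list pmf" where
  "rv Pr f = map_pmf (\<lambda>y. y f) Pr"

definition stoch_code :: "'n sncp \<Rightarrow> ('n \<Rightarrow> 'b list) pmf \<Rightarrow> bool" where
  "stoch_code P Pr \<longleftrightarrow>
     (\<forall>y\<in>set_pmf Pr. \<forall>f. f \<notin> idx P \<longrightarrow> y f = []) \<and>
     (\<forall>f\<in>idx P. finite (set_pmf (rv Pr f))) \<and>
     (\<forall>s\<in>srcs P. rv Pr s = pmf_of_set (set_pmf (rv Pr s))) \<and>
     ent_fun Pr \<in> C_I P \<inter> C_T P"

text \<open>q-linear: GF(q) is any finite field 'q of order q. Sources and keys are uniform row
vectors (entries i.i.d. uniform); each link is a GF(q)-linear map (written as a matrix c)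
of the concatenation of its inputs Y_in(e) and the local key Y_tail(e).\<close>

definition q_linear_code :: "'q::{field,finite} itself \<Rightarrow> 'n sncp \<Rightarrow> ('n \<Rightarrow> 'q list) pmf \<Rightarrow> bool" where
  "q_linear_code _ P Pr \<longleftrightarrow> stoch_code P Pr \<and>
     (\<forall>f\<in>srcs P \<union> nods P. \<exists>k. rv Pr f = pmf_of_set {xs. length xs = k}) \<and>
     (\<forall>e\<in>lnks P. \<exists>(m::nat) (c :: nat \<Rightarrow> 'n \<Rightarrow> nat \<Rightarrow> 'q). \<forall>y\<in>set_pmf Pr.
        y e = map (\<lambda>j. \<Sum>f\<in>in_edge P e \<union> {tl P e}. \<Sum>i<length (y f). c j f i * (y f ! i)) [0..<m])"

definition supp_size :: "('n \<Rightarrow> 'b list) pmf \<Rightarrow> 'n \<Rightarrow> nat" where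
  "supp_size Pr f = card (set_pmf (rv Pr f))"

definition achievable_qlin_ss ::
  "'q::{field,finite} itself \<Rightarrow> 'n sncp \<Rightarrow> ('n \<Rightarrow> real) \<Rightarrow> ('n \<Rightarrow> real) \<Rightarrow> bool" where
  "achievable_qlin_ss Q P lam om \<longleftrightarrow>
     (\<exists>(Y :: nat \<Rightarrow> ('n \<Rightarrow> 'q list) pmf) (c :: nat \<Rightarrow> real).
        (\<forall>n. q_linear_code Q P (Y n) \<and> c n > 0) \<and>
        (\<forall>e\<in>lnks P. \<exists>L. (\<lambda>n. c n * log 2 (supp_size (Y n) e)) \<longlonglongrightarrow> L \<and> L \<le> om e) \<and>
        (\<forall>s\<in>srcs P. \<exists>L. (\<lambda>n. c n * log 2 (supp_size (Y n) s)) \<longlonglongrightarrow> L \<and> L \<ge> lam s) \<and>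
        (\<forall>n. \<forall>s\<in>srcs P. \<forall>u\<in>dest P s. condh (ent_fun (Y n)) {s} (in_node P u) = 0) \<and>
        (\<forall>n. \<forall>(A,B)\<in>wtap P. meeth (ent_fun (Y n)) A B = 0))"

definition vscale :: "'q::field \<Rightarrow> (nat \<Rightarrow> 'q) \<Rightarrow> (nat \<Rightarrow> 'q)" where
  "vscale a v = (\<lambda>j. a * v j)"

text \<open>Subspaces of the finite-dimensional GF(q)-space GF(q)^d, realised as functions
nat \<Rightarrow> 'q vanishing from index d on.\<close>

definition q_representable :: "'q::{field,finite} itself \<Rightarrow> 'n set \<Rightarrow> ('n set \<Rightarrow> real) \<Rightarrow> bool" where
  "q_representable _ N h \<longleftrightarrow>
     (\<exists>(d::nat) (U :: 'n \<Rightarrow> (nat \<Rightarrow> 'q) set).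
        (\<forall>i\<in>N. module.subspace (vscale :: 'q \<Rightarrow> _) (U i) \<and> U i \<subseteq> {v. \<forall>j\<ge>d. v j = 0}) \<and>
        (\<forall>\<alpha>\<subseteq>N. h \<alpha> = real (vector_space.dim (vscale :: 'q \<Rightarrow> _)
                                 (module.span (vscale :: 'q \<Rightarrow> _) (\<Union>i\<in>\<alpha>. U i)))))"

definition weakly_q_representable :: "'q::{field,finite} itself \<Rightarrow> 'n set \<Rightarrow> ('n set \<Rightarrow> real) \<Rightarrow> bool" where
  "weakly_q_representable Q N h \<longleftrightarrow> (\<exists>c>0. q_representable Q N (\<lambda>\<alpha>. c * h \<alpha>))"

definition almost_q_representable :: "'q::{field,finite} itself \<Rightarrow> 'n set \<Rightarrow> ('n set \<Rightarrow> real) \<Rightarrow> bool" where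
  "almost_q_representable Q N h \<longleftrightarrow>
     (\<exists>g :: nat \<Rightarrow> 'n set \<Rightarrow> real. (\<forall>k. weakly_q_representable Q N (g k)) \<and>
        (\<forall>\<alpha>\<subseteq>N. (\<lambda>k. g k \<alpha>) \<longlonglongrightarrow> h \<alpha>))"

definition Ups_bar :: "'q::{field,finite} itself \<Rightarrow> 'n sncp \<Rightarrow> ('n set \<Rightarrow> real) set" where
  "Ups_bar Q P = {h. almost_q_representable Q (idx P) h}"

definition proj :: "('n set \<Rightarrow> real) \<Rightarrow> ('n \<Rightarrow> real) \<times> ('n \<Rightarrow> real)" where
  "proj h = ((\<lambda>s. h {s}), (\<lambda>e. h {e}))"

definition CL :: "'n sncp \<Rightarrow> (('n \<Rightarrow> real) \<times> ('n \<Rightarrow> real)) set \<Rightarrow> (('n \<Rightarrow> real) \<times> ('n \<Rightarrow> real)) set" where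
  "CL P R = {(lam, om). \<exists>(t :: nat \<Rightarrow> ('n \<Rightarrow> real) \<times> ('n \<Rightarrow> real)) (c :: nat \<Rightarrow> real).
      (\<forall>n. t n \<in> R \<and> c n > 0) \<and>
      (\<forall>e\<in>lnks P. \<exists>L. (\<lambda>n. c n * snd (t n) e) \<longlonglongrightarrow> L \<and> L \<le> om e) \<and>
      (\<forall>s\<in>srcs P. \<exists>L. (\<lambda>n. c n * fst (t n) s) \<longlonglongrightarrow> L \<and> L \<ge> lam s)}"

end

theory Submission
  imports Defs "HOL-Probability.Product_PMF"
begin

text \<open>
  A \<open>q\<close>-linear code whose sources and keys are jointly independent is a pushforward of a uniform vector
  \<open>x\<close> of \<open>GF(q)\<^sup>d\<close>: \<open>Y\<^sub>f\<close> lists the scalar products of \<open>x\<close> with vectors spanning a subspace \<open>U\<^sub>f\<close>, and the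
  entropy of a subfamily is \<open>log q\<close> times the dimension of the sum of the corresponding subspaces.
  This settles the direction from codes to almost representable functions.

  Conversely, an almost representable \<open>h\<close> satisfying the constraints gives subspaces \<open>U\<^sub>f\<close> that satisfy
  them up to a defect that is small compared with the dimensions. They are made exact at the cost of a
  constant multiple of the defect. A basis of the sum of all source and key spaces, chosen from their
  union, makes these spaces independent. Following the links in topological order, \<open>U\<^sub>e\<close> is intersected with the
  sum of the spaces available at the tail of \<open>e\<close>. Finally each source space is split as
  \<open>X\<^sub>s \<oplus> R\<^sub>s\<close>, where \<open>X\<^sub>s\<close> is decodable at all sinks of \<open>s\<close> and \<open>R\<^sub>s\<close> is small and contains whatever
  an adversary learns. The new source is \<open>X\<^sub>s\<close>, and \<open>R\<^sub>s\<close> becomes part of the key of the unique node at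
  which \<open>s\<close> is available, so that no link has to change. Sinks lose nothing: since the network is acyclic, the
  links entering that node do not depend on \<open>s\<close>, so a sink located there decodes the other
  sources from its incoming links alone.
\<close>

section \<open>Subspaces of \<open>GF(q)\<^sup>d\<close>\<close>

interpretation vs: vector_space "vscale :: 'q::field \<Rightarrow> (nat \<Rightarrow> 'q) \<Rightarrow> nat \<Rightarrow> 'q"
  by unfold_locales (auto simp: vscale_def fun_eq_iff algebra_simps)

text \<open>Pairing the space with its own field makes linear functionals available;
  \<open>dot_surj\<close> builds one from its values on an independent set.\<close>

interpretation vsp: vector_space_pair "vscale :: 'q::field \<Rightarrow> (nat \<Rightarrow> 'q) \<Rightarrow> nat \<Rightarrow> 'q" "(*) :: 'q \<Rightarrow> 'q \<Rightarrow> 'q"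
  by unfold_locales

definition fvec :: "nat \<Rightarrow> (nat \<Rightarrow> 'q::field) set" where
  "fvec d = {v. \<forall>j\<ge>d. v j = 0}"

definition dot :: "nat \<Rightarrow> (nat \<Rightarrow> 'q::field) \<Rightarrow> (nat \<Rightarrow> 'q) \<Rightarrow> 'q" where
  "dot d b x = (\<Sum>j<d. b j * x j)"

lemma subspace_fvec: "vs.subspace (fvec d :: (nat \<Rightarrow> 'q::field) set)"
  by (rule vs.subspaceI) (auto simp: fvec_def vscale_def)

lemma finite_fvec [simp]: "finite (fvec d :: (nat \<Rightarrow> 'q::{field,finite}) set)"
proof -
  have "fvec d = {f :: nat \<Rightarrow> 'q. \<forall>x. (x \<in> {..<d} \<longrightarrow> f x \<in> UNIV) \<and> (x \<notin> {..<d} \<longrightarrow> f x = 0)}"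
    by (auto simp: fvec_def)
  also have "finite \<dots>" by (rule finite_set_of_finite_funs) auto
  finally show ?thesis .
qed

lemma span_subset_fvec: "A \<subseteq> fvec d \<Longrightarrow> vs.span A \<subseteq> (fvec d :: (nat \<Rightarrow> 'q::field) set)"
  by (simp add: vs.span_minimal subspace_fvec)

lemma zero_fvec [simp]: "0 \<in> fvec d"
  by (simp add: fvec_def)

lemma dot_simps:
  "dot d (a + b) x = dot d a x + dot d b x" "dot d 0 x = 0" "dot d (vscale k b) x = k * dot d b x"
  "dot d b (x + y) = dot d b x + dot d b y" "dot d b 0 = 0" "dot d b (x - y) = dot d b x - dot d b y"
  by (simp_all add: dot_def vscale_def algebra_simps sum.distrib sum_distrib_left sum_subtractf)

text \<open>The vectors that do not distinguish \<open>x\<close> from \<open>y\<close> form a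
  subspace; containing \<open>C\<close>, it contains the span of \<open>C\<close>.\<close>

lemma dot_span_eq:
  assumes "b \<in> vs.span C" "\<And>c. c \<in> C \<Longrightarrow> dot d c x = dot d c y"
  shows "dot d b x = dot d b y"
proof -
  have "vs.subspace {b. dot d b x = dot d b y}"
    by (rule vs.subspaceI) (auto simp only: mem_Collect_eq dot_simps)
  then have "vs.span C \<subseteq> {b. dot d b x = dot d b y}"
    using assms(2) by (intro vs.span_minimal) auto
  then show ?thesis using assms(1) by auto
qed

lemma sum_fun_apply: "(\<Sum>j\<in>A. f j) i = (\<Sum>j\<in>A. f j i :: 'b::comm_monoid_add)"
  by (induction A rule: infinite_finite_induct) auto

lemma fvec_expand:
  assumes "v \<in> fvec d"
  shows "v = (\<Sum>j<d. vscale (v j) (\<lambda>i. if i = j then 1 else 0 :: 'q::field))"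
proof
  fix i
  have "(\<Sum>j<d. vscale (v j) (\<lambda>i. if i = j then 1 else 0 :: 'q)) i = (\<Sum>j<d. if i = j then v j else 0)"
    unfolding sum_fun_apply vscale_def by (intro sum.cong) auto
  also have "\<dots> = v i" using assms by (simp add: fvec_def)
  finally show "v i = (\<Sum>j<d. vscale (v j) (\<lambda>i. if i = j then 1 else 0)) i" by simp
qed

text \<open>Prescribed values on an independent set extend to a linear functional, and on
  \<open>fvec d\<close> a functional is the scalar product with the vector of its values on the unit
  vectors.\<close>

lemma dot_surj:
  fixes C :: "(nat \<Rightarrow> 'q::field) set"
  assumes "vs.independent C" "C \<subseteq> fvec d"
  shows "\<exists>x\<in>fvec d. \<forall>c\<in>C. dot d c x = g c"
proof -
  define L where "L = vsp.construct C g"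
  have lin: "Vector_Spaces.linear vscale (*) L" unfolding L_def by (rule vsp.linear_construct[OF assms(1)])
  define x where "x = (\<lambda>j. if j < d then L (\<lambda>i. if i = j then 1 else 0) else 0)"
  have "dot d c x = g c" if c: "c \<in> C" for c
  proof -
    have "g c = L c" unfolding L_def using c assms(1) by (simp add: vsp.construct_basis)
    also have "\<dots> = L (\<Sum>j<d. vscale (c j) (\<lambda>i. if i = j then 1 else 0))"
      using fvec_expand[of c d] c assms(2) by auto
    also have "\<dots> = dot d c x"
      by (simp add: vsp.linear_sum[OF lin] vsp.linear_scale[OF lin] dot_def x_def)
    finally show ?thesis by simp
  qed
  moreover have "x \<in> fvec d" by (simp add: x_def fvec_def)
  ultimately show ?thesis by blast
qed

section \<open>Dimension by counting over a finite field\<close>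

lemma card_const_fibers:
  assumes "finite A" "\<And>z. z \<in> f ` A \<Longrightarrow> card {x\<in>A. f x = z} = k"
  shows "card A = k * card (f ` A)"
proof -
  have "card A = (\<Sum>z\<in>f ` A. card {x\<in>A. f x = z})"
    using sum.group[of A "f ` A" f "\<lambda>_. 1 :: nat"] assms(1) by simp
  then show ?thesis using assms by simp
qed

lemma two_le_card_field: "2 \<le> CARD('q::{field,finite})"
proof -
  have "card {0, 1 :: 'q} \<le> CARD('q)" by (rule card_mono) auto
  then show ?thesis by simp
qed

text \<open>A further basis vector \<open>a\<close> multiplies the size by q: every element of the
  larger span is \<open>vscale k a + v\<close> for exactly one scalar \<open>k\<close> and one
  \<open>v\<close> in the smaller span.\<close>

lemma card_span_independent:
  fixes B :: "(nat \<Rightarrow> 'q::{field,finite}) set"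
  assumes "finite B" "vs.independent B"
  shows "card (vs.span B) = CARD('q) ^ card B \<and> finite (vs.span B)"
  using assms
proof (induction B rule: finite_induct)
  case (insert a B)
  then have ind: "vs.independent B" "a \<notin> vs.span B"
    by (auto simp: vs.independent_insert)
  let ?f = "\<lambda>(k, v). vscale k a + v"
  have img: "vs.span (insert a B) = ?f ` (UNIV \<times> vs.span B)"
  proof (intro set_eqI iffI)
    fix x assume "x \<in> vs.span (insert a B)"
    then obtain k where "x - vscale k a \<in> vs.span B" by (auto simp: vs.span_breakdown_eq)
    then show "x \<in> ?f ` (UNIV \<times> vs.span B)" by (intro image_eqI[of _ _ "(k, x - vscale k a)"]) auto
  next
    fix x assume "x \<in> ?f ` (UNIV \<times> vs.span B)"
    then obtain k v where "v \<in> vs.span B" "x = vscale k a + v" by auto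
    then show "x \<in> vs.span (insert a B)"
      by (auto simp: vs.span_breakdown_eq intro!: exI[of _ k])
  qed
  have "inj_on ?f (UNIV \<times> vs.span B)"
  proof (rule inj_onI, clarify)
    fix k v l w assume v: "v \<in> vs.span B" "w \<in> vs.span B" and e: "vscale k a + v = vscale l a + w"
    have "vscale (k - l) a = w - v" using e by (simp add: vs.scale_left_diff_distrib algebra_simps)
    then have s: "vscale (k - l) a \<in> vs.span B" using v by (simp add: vs.span_diff)
    have "k = l"
    proof (rule ccontr)
      assume "k \<noteq> l"
      then have "a = vscale (inverse (k - l)) (vscale (k - l) a)" by simp
      then show False using s ind(2) vs.span_scale by metis
    qed
    then show "k = l \<and> v = w" using e by simp
  qed
  then have "card (vs.span (insert a B)) = CARD('q) * card (vs.span B)"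
    by (simp add: img card_image card_cartesian_product)
  then show ?case using insert ind img by simp
qed simp

text \<open>Counting replaces basis arguments: as q is at least 2, the dimension can be read off the
  cardinality, and monotonicity and modularity of dimension below come from counting
  elements.\<close>

lemma card_subspace:
  fixes S :: "(nat \<Rightarrow> 'q::{field,finite}) set"
  assumes "vs.subspace S" "finite S"
  shows "card S = CARD('q) ^ vs.dim S"
proof -
  obtain B where B: "B \<subseteq> S" "vs.independent B" "S \<subseteq> vs.span B" "card B = vs.dim S"
    using vs.basis_exists by blast
  then have "vs.span B = S" using assms by (metis subset_antisym vs.span_minimal)
  then show ?thesis using card_span_independent[of B] B assms(2) finite_subset by metis
qed

lemma dim_mono:
  fixes S T :: "(nat \<Rightarrow> 'q::{field,finite}) set"
  assumes "vs.subspace S" "vs.subspace T" "finite T" "S \<subseteq> T"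
  shows "vs.dim S \<le> vs.dim T"
proof -
  have "card S \<le> card T" using assms by (simp add: card_mono)
  then have "CARD('q) ^ vs.dim S \<le> CARD('q) ^ vs.dim T"
    using assms card_subspace finite_subset by metis
  then show ?thesis using two_le_card_field[where 'q='q] by (auto intro: power_le_imp_le_exp[of "CARD('q)", rotated])
qed

lemma subspace_dim_eq:
  fixes S T :: "(nat \<Rightarrow> 'q::{field,finite}) set"
  assumes "vs.subspace S" "vs.subspace T" "finite T" "S \<subseteq> T" "vs.dim T \<le> vs.dim S"
  shows "S = T"
proof -
  have "vs.dim S = vs.dim T" using dim_mono[OF assms(1-4)] assms(5) by simp
  then have "card S = card T" using card_subspace assms finite_subset by metis
  then show ?thesis using assms by (simp add: card_subset_eq)
qed

text \<open>Addition maps \<open>S \<times> T\<close> onto the span of the union, and every fibre is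
  a copy of the intersection. Comparing cardinalities gives the formula in the exponents of
  q.\<close>

lemma dim_sum_Int:
  fixes S T :: "(nat \<Rightarrow> 'q::{field,finite}) set"
  assumes S: "vs.subspace S" "finite S" and T: "vs.subspace T" "finite T"
  shows "vs.dim (vs.span (S \<union> T)) + vs.dim (S \<inter> T) = vs.dim S + vs.dim T"
proof -
  have img: "vs.span (S \<union> T) = (\<lambda>(x, y). x + y) ` (S \<times> T)"
    using S T by (auto simp: vs.span_Un vs.span_eq_iff[THEN iffD2])
  have fib: "card {p\<in>S \<times> T. (\<lambda>(x, y). x + y) p = z} = card (S \<inter> T)"
    if "z \<in> (\<lambda>(x, y). x + y) ` (S \<times> T)" for z
  proof -
    obtain x y where xy: "x \<in> S" "y \<in> T" "z = x + y" using \<open>z \<in> _\<close> by auto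
    \<comment> \<open>One solution \<open>(x, y)\<close> of \<open>x + y = z\<close> yields all
      others by moving a vector of the intersection from the second summand to the first.\<close>
    have "bij_betw (\<lambda>v. (x + v, y - v)) (S \<inter> T) {p\<in>S \<times> T. (\<lambda>(x, y). x + y) p = z}"
    proof (rule bij_betwI[where g = "\<lambda>(a, b). a - x"])
      show "(\<lambda>v. (x + v, y - v)) \<in> S \<inter> T \<rightarrow> {p \<in> S \<times> T. (case p of (x, y) \<Rightarrow> x + y) = z}"
        using xy S T by (auto simp: vs.subspace_add vs.subspace_diff)
      show "(\<lambda>(a, b). a - x) \<in> {p \<in> S \<times> T. (case p of (x, y) \<Rightarrow> x + y) = z} \<rightarrow> S \<inter> T"
      proof
        fix p assume "p \<in> {p \<in> S \<times> T. (case p of (x, y) \<Rightarrow> x + y) = z}"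
        then obtain a b where ab: "p = (a, b)" "a \<in> S" "b \<in> T" "a + b = z" by auto
        have "a - x \<in> S" using ab xy S vs.subspace_diff by metis
        have "a - x = y - b" using xy ab by (simp add: algebra_simps)
        then have "a - x \<in> T" using ab xy S T vs.subspace_diff by metis
        with \<open>a - x \<in> S\<close> show "(case p of (a, b) \<Rightarrow> a - x) \<in> S \<inter> T" using ab(1) by simp
      qed
    qed (use xy in \<open>auto simp: algebra_simps\<close>)
    then show ?thesis by (simp add: bij_betw_same_card)
  qed
  have "card S * card T = card (S \<inter> T) * card (vs.span (S \<union> T))"
    using card_const_fibers[OF _ fib] S T by (simp add: img card_cartesian_product)
  moreover have "finite (vs.span (S \<union> T))" using img S T by simp
  ultimately have "CARD('q) ^ (vs.dim S + vs.dim T) = CARD('q) ^ (vs.dim (vs.span (S \<union> T)) + vs.dim (S \<inter> T))"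
    using S T by (simp add: card_subspace vs.subspace_inter power_add algebra_simps)
  then show ?thesis using two_le_card_field[where 'q='q] by (subst (asm) power_inject_exp) auto
qed

lemma dim_span_le_card:
  fixes B :: "(nat \<Rightarrow> 'q::{field,finite}) set"
  assumes "finite B"
  shows "vs.dim (vs.span B) \<le> card B"
  using vs.dim_le_card[of B B] assms by (simp add: vs.span_superset)

lemma span_Un_span: "vs.span (vs.span A \<union> vs.span B) = vs.span (A \<union> B)"
  by (simp add: vs.span_Un vs.span_span)

lemma dim_zero [simp]: "vs.dim ({0} :: (nat \<Rightarrow> 'q::{field,finite}) set) = 0"
  using vs.dim_le_card[of "{0}" "{}"] by simp

lemma independent_if_card_le_dim:
  fixes A :: "(nat \<Rightarrow> 'q::{field,finite}) set"
  assumes "finite A" "card A \<le> vs.dim (vs.span A)"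
  shows "vs.independent A"
proof (rule ccontr)
  assume "\<not> vs.independent A"
  then obtain a where a: "a \<in> A" "a \<in> vs.span (A - {a})" unfolding vs.dependent_def by blast
  then have "vs.span A = vs.span (A - {a})"
    by (metis insert_Diff vs.span_redundant)
  then have "vs.dim (vs.span A) \<le> card (A - {a})"
    using dim_span_le_card[of "A - {a}"] assms(1) by simp
  moreover have "card (A - {a}) < card A" using a(1) assms(1) by (rule_tac card_Diff1_less)
  ultimately show False using assms(2) by simp
qed

text \<open>Bases of \<open>K0\<close> and \<open>K\<close> are jointly independent because the two
  spaces meet trivially. Extending their union to a basis of \<open>S\<close> and removing the basis
  of \<open>K\<close> leaves a basis of a complement that still contains \<open>K0\<close>.
  Prescribing \<open>K0\<close> later places what adversaries learn in the discarded part of a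
  source.\<close>

lemma subspace_complement:
  fixes S K :: "(nat \<Rightarrow> 'q::{field,finite}) set"
  assumes "vs.subspace S" "finite S" "vs.subspace K" "K0 \<subseteq> S" "vs.subspace K0" "K \<subseteq> S" "K \<inter> K0 = {0}"
  shows "\<exists>C. vs.subspace C \<and> K0 \<subseteq> C \<and> C \<subseteq> S \<and> C \<inter> K = {0} \<and> vs.span (C \<union> K) = S \<and> vs.dim C + vs.dim K = vs.dim S"
proof -
  obtain A where A: "A \<subseteq> K0" "vs.independent A" "vs.span A = K0" "card A = vs.dim K0"
    using vs.basis_exists[of K0] assms vs.span_subspace by metis
  obtain D where D: "D \<subseteq> K" "vs.independent D" "vs.span D = K" "card D = vs.dim K"
    using vs.basis_exists[of K] assms vs.span_subspace by metis
  have finK: "finite K" and finK0: "finite K0" using assms(2,4,6) finite_subset by auto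
  have fin: "finite A" "finite D" using A(1) D(1) finK finK0 finite_subset by auto
  have "vs.dim (vs.span (A \<union> D)) = card A + card D"
  proof -
    have "vs.span (A \<union> D) = vs.span (K0 \<union> K)" using span_Un_span[of A D] A(3) D(3) by simp
    moreover have "vs.dim (K0 \<inter> K) = 0" using assms(7) by (simp add: Int_commute)
    ultimately show ?thesis
      using dim_sum_Int[OF assms(5) finK0 assms(3) finK] A(4) D(4) by simp
  qed
  moreover have "card (A \<union> D) \<le> card A + card D" by (rule card_Un_le)
  ultimately have ind: "vs.independent (A \<union> D)"
    by (intro independent_if_card_le_dim) (use fin in auto)
  have sub: "A \<union> D \<subseteq> S" using A(1) D(1) assms(4,6) by blast
  obtain E where E: "A \<union> D \<subseteq> E" "E \<subseteq> S" "vs.independent E" "S \<subseteq> vs.span E"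
    using vs.maximal_independent_subset_extend[OF sub ind] by metis
  have finE: "finite E" using E(2) assms(2) by (rule finite_subset)
  have spE: "vs.span E = S" using vs.span_subspace[OF E(2,4) assms(1)] .
  define C where "C = vs.span (E - D)"
  have C1: "vs.subspace C" "C \<subseteq> S" unfolding C_def using E(2) assms(1) vs.span_minimal[of "E - D" S] by auto
  have finC: "finite C" using C1(2) assms(2) finite_subset by auto
  have indED: "vs.independent (E - D)" using E(3) vs.independent_mono by blast
  have dC: "vs.dim C = card (E - D)"
    unfolding C_def by (rule vs.dim_span_eq_card_independent[OF indED])
  have dS: "vs.dim S = card E" using vs.dim_span_eq_card_independent[OF E(3)] spE by simp
  have dims: "vs.dim C + vs.dim K = vs.dim S"
  proof -
    have "D \<subseteq> E" using E(1) by simp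
    then show ?thesis using card_Diff_subset[of D E] card_mono[of E D] dC dS D(4) finE fin(2) by simp
  qed
  have sp: "vs.span (C \<union> K) = S"
  proof -
    have "vs.span (C \<union> K) = vs.span ((E - D) \<union> D)" unfolding C_def using span_Un_span[of "E - D" D] D(3) by simp
    also have "(E - D) \<union> D = E" using E(1) by auto
    finally show ?thesis using spE by simp
  qed
  have "vs.dim (C \<inter> K) = 0"
    using dim_sum_Int[OF C1(1) finC assms(3) finK] sp dims by simp
  then have "{0} = C \<inter> K"
    using C1(1) assms(3) finC
    by (intro subspace_dim_eq) (auto simp: vs.subspace_0 vs.subspace_inter)
  moreover have "A \<subseteq> E - D"
  proof -
    have "A \<inter> D \<subseteq> {0}" using A(1) D(1) assms(7) by blast
    moreover have "0 \<notin> A" using A(2) vs.dependent_zero by blast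
    ultimately show ?thesis using E(1) by blast
  qed
  then have "K0 \<subseteq> C" unfolding C_def A(3)[symmetric] by (rule vs.span_mono)
  ultimately show ?thesis using C1 sp dims by blast
qed

section \<open>Sums of families of subspaces\<close>

lemma span_UN_span: "vs.span (\<Union>f\<in>\<alpha>. vs.span (S f)) = vs.span (\<Union>f\<in>\<alpha>. S f)"
proof (rule subset_antisym)
  show "vs.span (\<Union>f\<in>\<alpha>. vs.span (S f)) \<subseteq> vs.span (\<Union>f\<in>\<alpha>. S f)"
    by (intro vs.span_minimal UN_least vs.span_mono UN_upper) auto
  show "vs.span (\<Union>f\<in>\<alpha>. S f) \<subseteq> vs.span (\<Union>f\<in>\<alpha>. vs.span (S f))"
    using vs.span_superset by (intro vs.span_mono) blast
qed

text \<open>For subspaces this is their sum; as a function of \<open>I\<close> its dimension is the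
  function that the family represents.\<close>

definition ssum :: "('i \<Rightarrow> (nat \<Rightarrow> 'q::field) set) \<Rightarrow> 'i set \<Rightarrow> (nat \<Rightarrow> 'q) set" where
  "ssum U I = vs.span (\<Union>i\<in>I. U i)"

lemma subspace_ssum [simp]: "vs.subspace (ssum U I)"
  by (simp add: ssum_def)

lemma ssum_mono: "I \<subseteq> J \<Longrightarrow> (\<And>i. i \<in> I \<Longrightarrow> U i \<subseteq> U' i) \<Longrightarrow> ssum U I \<subseteq> ssum U' J"
  unfolding ssum_def by (rule vs.span_mono) blast

lemma in_ssum: "i \<in> I \<Longrightarrow> U i \<subseteq> ssum U I"
  unfolding ssum_def using vs.span_superset by blast

lemma ssum_minimal: "vs.subspace S \<Longrightarrow> (\<And>i. i \<in> I \<Longrightarrow> U i \<subseteq> S) \<Longrightarrow> ssum U I \<subseteq> S"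
  unfolding ssum_def by (rule vs.span_minimal) blast+

lemma ssum_Un: "ssum U (I \<union> J) = vs.span (ssum U I \<union> ssum U J)"
  unfolding ssum_def span_Un_span by (simp add: UN_Un)

lemma ssum_insert: "ssum U (insert i I) = vs.span (vs.span (U i) \<union> ssum U I)"
  unfolding ssum_def span_Un_span by simp

lemma ssum_subset_fvec: "(\<And>i. i \<in> I \<Longrightarrow> U i \<subseteq> fvec d) \<Longrightarrow> ssum U I \<subseteq> fvec d"
  by (rule ssum_minimal[OF subspace_fvec])

lemma ssum_cong: "(\<And>i. i \<in> I \<Longrightarrow> U i = U' i) \<Longrightarrow> ssum U I = ssum U' I"
  unfolding ssum_def by simp

lemma ssum_singleton: "vs.subspace (U i) \<Longrightarrow> ssum U {i} = U i"
  by (simp add: ssum_def)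

lemma dim_span_Un_le:
  fixes S T :: "(nat \<Rightarrow> 'q::{field,finite}) set"
  assumes "vs.subspace S" "finite S" "vs.subspace T" "finite T"
  shows "vs.dim (vs.span (S \<union> T)) \<le> vs.dim S + vs.dim T"
  using dim_sum_Int[OF assms] by simp

lemma dim_ssum_le:
  fixes U :: "'i \<Rightarrow> (nat \<Rightarrow> 'q::{field,finite}) set"
  assumes "finite I" "\<And>i. i \<in> I \<Longrightarrow> vs.subspace (U i)" "\<And>i. i \<in> I \<Longrightarrow> U i \<subseteq> fvec d"
  shows "vs.dim (ssum U I) \<le> (\<Sum>i\<in>I. vs.dim (U i))"
  using assms
proof (induction I rule: finite_induct)
  case empty
  then show ?case by (simp add: ssum_def)
next
  case (insert i I)
  have 1: "vs.span (U i) = U i" using insert.prems(1) by simp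
  have "finite (U i)" using insert.prems(2) finite_subset[OF _ finite_fvec] by blast
  moreover have "finite (ssum U I)"
    using insert.prems(2) ssum_subset_fvec[of I U d] finite_subset[OF _ finite_fvec] by blast
  ultimately have "vs.dim (ssum U (insert i I)) \<le> vs.dim (U i) + vs.dim (ssum U I)"
    unfolding ssum_insert 1 using insert.prems(1) by (intro dim_span_Un_le) auto
  also have "\<dots> \<le> vs.dim (U i) + (\<Sum>i\<in>I. vs.dim (U i))" using insert by simp
  finally show ?case using insert by simp
qed

text \<open>Each \<open>U i\<close> is spanned by \<open>U' i\<close> and a complement whose
  dimension is the loss at \<open>i\<close>. The sum of the complements has at most the total loss
  as its dimension, and together with the sum of the \<open>U' i\<close> it covers the sum of the
  \<open>U i\<close>.\<close>

lemma dim_ssum_loss: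
  fixes U U' :: "'i \<Rightarrow> (nat \<Rightarrow> 'q::{field,finite}) set"
  assumes I: "finite I" and U: "\<And>i. i \<in> I \<Longrightarrow> vs.subspace (U i)" "\<And>i. i \<in> I \<Longrightarrow> U i \<subseteq> fvec d"
    and U': "\<And>i. i \<in> I \<Longrightarrow> vs.subspace (U' i)" "\<And>i. i \<in> I \<Longrightarrow> U' i \<subseteq> U i"
  shows "vs.dim (ssum U I) \<le> vs.dim (ssum U' I) + (\<Sum>i\<in>I. vs.dim (U i) - vs.dim (U' i))"
proof -
  have "\<exists>C. vs.subspace C \<and> C \<subseteq> U i \<and> vs.span (C \<union> U' i) = U i \<and> vs.dim C + vs.dim (U' i) = vs.dim (U i)"
    if "i \<in> I" for i
    using subspace_complement[of "U i" "U' i" "{0}"] U[OF that] U'[OF that]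
      finite_subset[OF _ finite_fvec, of "U i"] vs.subspace_0
    by (metis (no_types, lifting) Int_insert_right_if1 Int_empty_right bot_least insert_subset vs.subspace_single_0)
  then obtain C where C: "\<And>i. i \<in> I \<Longrightarrow> vs.subspace (C i) \<and> C i \<subseteq> U i \<and> vs.span (C i \<union> U' i) = U i \<and> vs.dim (C i) + vs.dim (U' i) = vs.dim (U i)"
    by metis
  have Cf: "C i \<subseteq> fvec d" "U' i \<subseteq> fvec d" if "i \<in> I" for i using C U U' that by blast+
  have sub: "ssum U' I \<subseteq> fvec d" "ssum C I \<subseteq> fvec d"
    using ssum_subset_fvec[of I U' d] ssum_subset_fvec[of I C d] Cf by auto
  then have "vs.span (ssum U' I \<union> ssum C I) \<subseteq> fvec d" by (intro span_subset_fvec) auto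
  with sub have fin: "finite (ssum U' I)" "finite (ssum C I)" "finite (vs.span (ssum U' I \<union> ssum C I))"
    by (auto intro: finite_subset[OF _ finite_fvec])
  have "ssum U I \<subseteq> vs.span (ssum U' I \<union> ssum C I)"
  proof (rule ssum_minimal)
    fix i assume i: "i \<in> I"
    then have "vs.span (C i \<union> U' i) \<subseteq> vs.span (ssum U' I \<union> ssum C I)"
      using in_ssum[of i I C] in_ssum[of i I U'] by (intro vs.span_mono) blast
    then show "U i \<subseteq> vs.span (ssum U' I \<union> ssum C I)" using C i by simp
  qed simp
  then have "vs.dim (ssum U I) \<le> vs.dim (vs.span (ssum U' I \<union> ssum C I))"
    using fin by (intro dim_mono) auto
  also have "\<dots> \<le> vs.dim (ssum U' I) + vs.dim (ssum C I)"
    using fin by (intro dim_span_Un_le) auto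
  also have "vs.dim (ssum C I) \<le> (\<Sum>i\<in>I. vs.dim (C i))"
    using C Cf I by (intro dim_ssum_le[where d = d]) auto
  also have "(\<Sum>i\<in>I. vs.dim (C i)) = (\<Sum>i\<in>I. vs.dim (U i) - vs.dim (U' i))"
    using C by (intro sum.cong refl) (metis add_diff_cancel_right')
  finally show ?thesis by simp
qed

lemma ssum_decompose:
  assumes I: "finite I" and U: "\<And>i. i \<in> I \<Longrightarrow> vs.subspace (U i)" and x: "x \<in> ssum U I"
  shows "\<exists>y. (\<forall>i\<in>I. y i \<in> U i) \<and> x = (\<Sum>i\<in>I. y i)"
  using I U x
proof (induction I arbitrary: x rule: finite_induct)
  case empty
  then show ?case by (simp add: ssum_def)
next
  case (insert i I)
  have "vs.span (U i) = U i" using insert.prems(1) by simp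
  then obtain u v where uv: "u \<in> U i" "v \<in> ssum U I" "x = u + v"
    using insert.prems(2) unfolding ssum_insert vs.span_Un[of "vs.span (U i)"] vs.span_span
    by (auto simp: vs.span_eq_iff[THEN iffD2])
  then obtain y where "\<forall>i\<in>I. y i \<in> U i" "v = (\<Sum>i\<in>I. y i)" using insert.IH insert.prems by auto
  moreover from this have "sum (y(i := u)) I = v" using insert.hyps by (auto intro!: sum.cong)
  then have "x = sum (y(i := u)) (insert i I)" 
    using sum.insert[OF insert.hyps, of "y(i := u)"] uv(3) by (simp only: fun_upd_same)
  ultimately show ?case using uv(1) by (intro exI[of _ "y(i := u)"]) simp
qed

text \<open>Every basis vector of \<open>K\<close> splits into components from the
  \<open>U i\<close>. Letting \<open>R i\<close> be spanned by the components at \<open>i\<close>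
  takes at most one generator per basis vector.\<close>

lemma ssum_small_cover:
  fixes U :: "'i \<Rightarrow> (nat \<Rightarrow> 'q::{field,finite}) set"
  assumes I: "finite I" and U: "\<And>i. i \<in> I \<Longrightarrow> vs.subspace (U i)"
    and K: "K \<subseteq> ssum U I" "finite K"
  shows "\<exists>R. (\<forall>i\<in>I. vs.subspace (R i) \<and> R i \<subseteq> U i \<and> vs.dim (R i) \<le> vs.dim K) \<and> K \<subseteq> ssum R I"
proof -
  obtain B where B: "B \<subseteq> K" "vs.independent B" "K \<subseteq> vs.span B" "card B = vs.dim K"
    using vs.basis_exists by blast
  have finB: "finite B" using B(1) K(2) finite_subset by auto
  have "\<forall>b\<in>B. \<exists>y. (\<forall>i\<in>I. y i \<in> U i) \<and> b = (\<Sum>i\<in>I. y i)"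
  proof
    fix b assume "b \<in> B"
    then have "b \<in> ssum U I" using B(1) K(1) by blast
    then show "\<exists>y. (\<forall>i\<in>I. y i \<in> U i) \<and> b = (\<Sum>i\<in>I. y i)" using ssum_decompose[OF I U] by simp
  qed
  then obtain y where y: "\<And>b. b \<in> B \<Longrightarrow> (\<forall>i\<in>I. y b i \<in> U i) \<and> b = (\<Sum>i\<in>I. y b i)" by metis
  define R where "R i = vs.span ((\<lambda>b. y b i) ` B)" for i
  have "vs.subspace (R i) \<and> R i \<subseteq> U i \<and> vs.dim (R i) \<le> vs.dim K" if "i \<in> I" for i
  proof -
    have "R i \<subseteq> U i" unfolding R_def using y that U by (intro vs.span_minimal) auto
    moreover have "vs.dim (R i) \<le> card ((\<lambda>b. y b i) ` B)"
      unfolding R_def using finB by (intro dim_span_le_card) auto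
    ultimately show ?thesis using card_image_le[OF finB, of "\<lambda>b. y b i"] B(4) unfolding R_def by simp
  qed
  moreover have "B \<subseteq> ssum R I"
  proof
    fix b assume b: "b \<in> B"
    have "y b i \<in> ssum R I" if "i \<in> I" for i
      using in_ssum[OF that, of R] b vs.span_base[of "y b i" "(\<lambda>b. y b i) ` B"] unfolding R_def by blast
    then have "(\<Sum>i\<in>I. y b i) \<in> ssum R I" by (intro vs.subspace_sum) auto
    then show "b \<in> ssum R I" using y[OF b] by simp
  qed
  then have "vs.span B \<subseteq> ssum R I" by (intro vs.span_minimal) auto
  ultimately show ?thesis using B(3) by blast
qed

text \<open>Disjointness makes the dimensions of the two spans add up to that of their sum, which
  leaves dimension zero for the intersection.\<close>

lemma span_Int_independent:
  fixes B1 B2 :: "(nat \<Rightarrow> 'q::{field,finite}) set"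
  assumes "vs.independent (B1 \<union> B2)" "B1 \<inter> B2 = {}" "finite B1" "finite B2"
  shows "vs.span B1 \<inter> vs.span B2 = {0}"
proof -
  have ind: "vs.independent B1" "vs.independent B2"
    using assms(1) vs.independent_mono by blast+
  have fin: "finite (vs.span B1)" "finite (vs.span B2)"
    using card_span_independent ind assms by blast+
  have d: "vs.dim (vs.span B1) = card B1" "vs.dim (vs.span B2) = card B2"
    "vs.dim (vs.span (B1 \<union> B2)) = card (B1 \<union> B2)"
    by (rule vs.dim_span_eq_card_independent, use ind assms(1) in simp)+
  then have "vs.dim (vs.span B1 \<inter> vs.span B2) = 0"
    using dim_sum_Int[of "vs.span B1" "vs.span B2"] fin assms unfolding span_Un_span
    by (simp only: d vs.subspace_span) (simp add: card_Un_disjoint)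
  then have "{0} = vs.span B1 \<inter> vs.span B2"
    using fin by (intro subspace_dim_eq) (auto simp: vs.span_zero vs.subspace_inter)
  then show ?thesis by simp
qed

section \<open>Entropy of linear families\<close>

lemma entropy_pmf_of_set:
  assumes "finite A" "A \<noteq> {}"
  shows "entropy_pmf (pmf_of_set A) = log 2 (card A)"
proof -
  have "(\<Sum>x\<in>A. pmf (pmf_of_set A) x * log 2 (pmf (pmf_of_set A) x)) = (\<Sum>x\<in>A. (1 / card A) * log 2 (1 / card A))"
    using assms by (intro sum.cong) auto
  also have "\<dots> = log 2 (1 / card A)" using assms by simp
  also have "\<dots> = - log 2 (card A)" using assms by (simp add: log_divide card_gt_0_iff)
  finally show ?thesis using assms by (simp add: entropy_pmf_def)
qed

lemma entropy_map_inj: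
  assumes "inj_on f (set_pmf p)"
  shows "entropy_pmf (map_pmf f p) = entropy_pmf p"
  unfolding entropy_pmf_def set_map_pmf
  using assms by (simp add: sum.reindex pmf_map_inj)

text \<open>This is the equality case of Gibbs' inequality. With \<open>t x\<close> the ratio of the
  uniform mass to \<open>pmf p x\<close>, the terms \<open>pmf p x * (t x - 1 - ln (t x))\<close>
  are nonnegative, and the entropy assumption makes their sum at most 0. So all of them vanish, and
  \<open>ln t = t - 1\<close> holds only for \<open>t = 1\<close>.\<close>

lemma entropy_max_imp_uniform:
  assumes A: "finite A" "set_pmf p \<subseteq> A" and H: "entropy_pmf p = log 2 (card A)"
  shows "p = pmf_of_set A"
proof -
  define S where "S = set_pmf p"
  define N where "N = real (card A)"
  have finS: "finite S" and SA: "S \<subseteq> A" and Sne: "S \<noteq> {}"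
    using A finite_subset unfolding S_def by (auto simp: set_pmf_not_empty)
  have N: "N > 0" unfolding N_def using A Sne SA by (auto simp: card_gt_0_iff)
  have pos: "pmf p x > 0" if "x \<in> S" for x using that unfolding S_def by (simp add: pmf_positive)
  have sum1: "(\<Sum>x\<in>S. pmf p x) = 1" using finS unfolding S_def by (simp add: sum_pmf_eq_1)
  define t where "t x = 1 / (N * pmf p x)" for x
  have tpos: "t x > 0" if "x \<in> S" for x using pos[OF that] N by (simp add: t_def)
  define F where "F x = pmf p x * (t x - 1 - ln (t x))" for x
  have Fnn: "F x \<ge> 0" if "x \<in> S" for x
    using ln_le_minus_one[OF tpos[OF that]] pos[OF that] by (simp add: F_def)
  have "(\<Sum>x\<in>S. pmf p x * ln (t x)) = 0"
  proof -
    have "(\<Sum>x\<in>S. pmf p x * ln (t x)) = (\<Sum>x\<in>S. - ln N * pmf p x - ln 2 * (pmf p x * log 2 (pmf p x)))"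
    proof (rule sum.cong)
      fix x assume "x \<in> S"
      then show "pmf p x * ln (t x) = - ln N * pmf p x - ln 2 * (pmf p x * log 2 (pmf p x))"
        using pos[of x] N by (simp add: t_def ln_div ln_mult log_def algebra_simps)
    qed simp
    also have "\<dots> = - ln N * (\<Sum>x\<in>S. pmf p x) - ln 2 * (\<Sum>x\<in>S. pmf p x * log 2 (pmf p x))"
      by (simp add: sum_subtractf sum_distrib_left)
    also have "\<dots> = - ln N + ln 2 * entropy_pmf p" unfolding sum1 by (simp add: entropy_pmf_def S_def)
    also have "\<dots> = 0" unfolding H by (simp add: log_def N_def)
    finally show ?thesis .
  qed
  moreover have "(\<Sum>x\<in>S. pmf p x * (t x - 1)) = card S / N - 1"
  proof -
    have "(\<Sum>x\<in>S. pmf p x * (t x - 1)) = (\<Sum>x\<in>S. 1 / N - pmf p x)"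
    proof (rule sum.cong)
      fix x assume "x \<in> S"
      then show "pmf p x * (t x - 1) = 1 / N - pmf p x"
        using pos[of x] N by (simp add: t_def field_simps)
    qed simp
    also have "\<dots> = card S / N - 1" by (simp add: sum_subtractf sum1)
    finally show ?thesis .
  qed
  ultimately have Fs: "(\<Sum>x\<in>S. F x) = card S / N - 1"
    by (simp add: F_def algebra_simps sum_subtractf sum.distrib)
  moreover have "card S \<le> card A" using SA A by (simp add: card_mono)
  then have "card S / N - 1 \<le> 0" using N by (simp add: N_def field_simps)
  moreover have "(\<Sum>x\<in>S. F x) \<ge> 0" using Fnn by (simp add: sum_nonneg)
  ultimately have F0: "(\<Sum>x\<in>S. F x) = 0" by simp
  \<comment> \<open>The vanishing sum also shows that the support is all of
    \<open>A\<close>.\<close>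
  then have "card S / N = 1" using Fs by simp
  then have "card S = card A" using N by (simp add: N_def)
  then have SeqA: "S = A" using SA A by (simp add: card_subset_eq)
  have "pmf p x = 1 / N" if "x \<in> A" for x
  proof -
    have x: "x \<in> S" using that SeqA by simp
    then have "F x = 0" using F0 Fnn finS by (simp add: sum_nonneg_eq_0_iff)
    then have "ln (t x) = t x - 1" using pos[OF x] by (simp add: F_def)
    then have "t x = 1" using tpos[OF x] ln_eq_minus_one by blast
    then show ?thesis using pos[OF x] N by (simp add: t_def field_simps)
  qed
  then show ?thesis using A SeqA S_def N_def Sne
    by (intro pmf_eqI) (auto simp: indicator_def pmf_eq_0_set_pmf)
qed

section \<open>Scalar products with a uniform vector\<close>

lemma map_pmf_of_set_const_fibers:
  assumes A: "finite A" "A \<noteq> {}" and k: "\<And>z. z \<in> f ` A \<Longrightarrow> card {x\<in>A. f x = z} = k"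
  shows "map_pmf f (pmf_of_set A) = pmf_of_set (f ` A)"
proof (rule pmf_eqI)
  fix z
  have cA: "card A = k * card (f ` A)" using card_const_fibers[OF A(1) k] .
  have eq: "A \<inter> f -` {z} = {x\<in>A. f x = z}" by auto
  have "pmf (map_pmf f (pmf_of_set A)) z = card {x\<in>A. f x = z} / card A"
    using A by (simp add: pmf_map measure_pmf_of_set eq)
  also have "\<dots> = indicator (f ` A) z / card (f ` A)"
  proof (cases "z \<in> f ` A")
    case True
    have "card A \<noteq> 0" using A by simp
    then show ?thesis using True k[OF True] cA by (simp add: field_simps)
  next
    case False
    then have e: "{x\<in>A. f x = z} = {}" by auto
    show ?thesis using False unfolding e by simp
  qed
  also have "\<dots> = pmf (pmf_of_set (f ` A)) z" using A by simp
  finally show "pmf (map_pmf f (pmf_of_set A)) z = pmf (pmf_of_set (f ` A)) z" .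
qed

text \<open>The fibres of \<open>g\<close> are cosets of the annihilator of \<open>T\<close>, hence
  equally large, and the image of the uniform distribution is uniform. The number of values follows
  by comparison with evaluation on a basis of \<open>T\<close>, which has the same fibres.\<close>

lemma dot_image_uniform:
  fixes T :: "(nat \<Rightarrow> 'q::{field,finite}) set"
  assumes T: "T \<subseteq> fvec d"
    and g: "\<And>x y. x \<in> fvec d \<Longrightarrow> y \<in> fvec d \<Longrightarrow> g x = g y \<longleftrightarrow> (\<forall>b\<in>T. dot d b x = dot d b y)"
  shows "map_pmf g (pmf_of_set (fvec d)) = pmf_of_set (g ` fvec d)"
    and "card (g ` fvec d) = CARD('q) ^ vs.dim (vs.span T)"
proof -
  let ?W = "fvec d :: (nat \<Rightarrow> 'q) set"
  define k where "k = card {x\<in>?W. \<forall>b\<in>T. dot d b x = 0}"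
  have fib: "card {x\<in>?W. \<forall>b\<in>T. dot d b x = dot d b x0} = k" if x0: "x0 \<in> ?W" for x0
  proof -
    have "{x\<in>?W. \<forall>b\<in>T. dot d b x = dot d b x0} = (\<lambda>x. x + x0) ` {x\<in>?W. \<forall>b\<in>T. dot d b x = 0}"
    proof (intro set_eqI iffI)
      fix x assume x: "x \<in> {x\<in>?W. \<forall>b\<in>T. dot d b x = dot d b x0}"
      then have "x - x0 \<in> {x\<in>?W. \<forall>b\<in>T. dot d b x = 0}"
        using x0 by (simp add: dot_simps vs.subspace_diff[OF subspace_fvec])
      then show "x \<in> (\<lambda>x. x + x0) ` {x\<in>?W. \<forall>b\<in>T. dot d b x = 0}"
        by (intro image_eqI[of _ _ "x - x0"]) simp_all
    next
      fix x assume "x \<in> (\<lambda>x. x + x0) ` {x\<in>?W. \<forall>b\<in>T. dot d b x = 0}"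
      then obtain y where "y \<in> ?W" "\<forall>b\<in>T. dot d b y = 0" "x = y + x0" by blast
      then show "x \<in> {x\<in>?W. \<forall>b\<in>T. dot d b x = dot d b x0}"
        using x0 by (simp add: dot_simps vs.subspace_add[OF subspace_fvec])
    qed
    then show ?thesis unfolding k_def by (simp add: card_image)
  qed
  have fibg: "card {x\<in>?W. g' x = z} = k" if z: "z \<in> g' ` ?W"
    and g': "\<And>x y. x \<in> ?W \<Longrightarrow> y \<in> ?W \<Longrightarrow> g' x = g' y \<longleftrightarrow> (\<forall>b\<in>T. dot d b x = dot d b y)"
  for z and g' :: "_ \<Rightarrow> 'z"
  proof -
    obtain x0 where x0: "x0 \<in> ?W" "z = g' x0" using z by auto
    then have "{x\<in>?W. g' x = z} = {x\<in>?W. \<forall>b\<in>T. dot d b x = dot d b x0}" using g' by auto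
    then show ?thesis using fib x0 by simp
  qed
  have ne: "?W \<noteq> {}" using zero_fvec by blast
  show "map_pmf g (pmf_of_set ?W) = pmf_of_set (g ` ?W)"
    using fibg[of _ g] g ne by (intro map_pmf_of_set_const_fibers) auto
  obtain C where C: "C \<subseteq> T" "vs.independent C" "T \<subseteq> vs.span C" "card C = vs.dim T"
    using vs.basis_exists by blast
  have CW: "C \<subseteq> ?W" using C T by blast
  have finC: "finite C" using CW finite_subset finite_fvec by blast
  \<comment> \<open>Evaluation on the basis \<open>C\<close> separates the same points as
    \<open>g\<close>, but its image is known: by independence every assignment of values to
    \<open>C\<close> occurs.\<close>
  define h where "h x = restrict (\<lambda>c. dot d c x) C" for x
  have h: "h x = h y \<longleftrightarrow> (\<forall>b\<in>T. dot d b x = dot d b y)" for x y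
  proof
    assume "h x = h y"
    then have "dot d c x = dot d c y" if "c \<in> C" for c
      unfolding h_def using that by (metis restrict_apply')
    then show "\<forall>b\<in>T. dot d b x = dot d b y" using dot_span_eq C(3) by blast
  next
    assume "\<forall>b\<in>T. dot d b x = dot d b y"
    then show "h x = h y" unfolding h_def using C(1) by (intro restrict_ext) blast
  qed
  have "h ` ?W = PiE C (\<lambda>_. UNIV)"
  proof (intro set_eqI iffI)
    fix u :: "(nat \<Rightarrow> 'q) \<Rightarrow> 'q" assume u: "u \<in> PiE C (\<lambda>_. UNIV)"
    obtain x where x: "x \<in> ?W" "\<forall>c\<in>C. dot d c x = u c" using dot_surj[OF C(2) CW] by blast
    then have "h x = u" unfolding h_def using u by (auto simp: fun_eq_iff PiE_def extensional_def)
    then show "u \<in> h ` ?W" using x by blast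
  qed (auto simp: h_def)
  then have ch: "card (h ` ?W) = CARD('q) ^ card C" using finC by (simp add: card_PiE)
  \<comment> \<open>Both maps split \<open>fvec d\<close> into fibres of size \<open>k\<close>, so
    their images are equally large.\<close>
  have "card ?W = k * card (h ` ?W)" by (rule card_const_fibers) (use fibg[of _ h] h in auto)
  moreover have "card ?W = k * card (g ` ?W)" by (rule card_const_fibers) (use fibg[of _ g] g in auto)
  moreover have "card ?W \<noteq> 0" using ne by simp
  ultimately have "card (g ` ?W) = card (h ` ?W)" by auto
  then show "card (g ` ?W) = CARD('q) ^ vs.dim (vs.span T)" using ch C(4) by simp
qed

text \<open>The common form of all linear codes: one uniform vector \<open>x\<close> carries all
  randomness, and \<open>bas f\<close> lists generators of the space that belongs to
  \<open>f\<close>.\<close>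

definition lin_pmf :: "nat \<Rightarrow> ('n \<Rightarrow> (nat \<Rightarrow> 'q::{field,finite}) list) \<Rightarrow> ('n \<Rightarrow> 'q list) pmf" where
  "lin_pmf d bas = map_pmf (\<lambda>x f. map (\<lambda>b. dot d b x) (bas f)) (pmf_of_set (fvec d))"

text \<open>Two vectors give the same masked assignment exactly when they have the same products
  with all generators indexed by \<alpha>, so \<open>dot_image_uniform\<close> applies to the union
  of these generators.\<close>

lemma ent_fun_lin_pmf:
  fixes bas :: "'n \<Rightarrow> (nat \<Rightarrow> 'q::{field,finite}) list"
  assumes "\<And>f. set (bas f) \<subseteq> fvec d"
  shows "ent_fun (lin_pmf d bas) \<alpha> = log 2 CARD('q) * vs.dim (vs.span (\<Union>f\<in>\<alpha>. set (bas f)))"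
proof -
  let ?W = "fvec d :: (nat \<Rightarrow> 'q) set"
  let ?T = "\<Union>f\<in>\<alpha>. set (bas f)"
  define g where "g x = (\<lambda>f. if f \<in> \<alpha> then map (\<lambda>b. dot d b x) (bas f) else [])" for x
  have g: "g x = g y \<longleftrightarrow> (\<forall>b\<in>?T. dot d b x = dot d b y)" for x y
    unfolding g_def fun_eq_iff by auto
  have T: "?T \<subseteq> ?W" using assms by blast
  have ne: "g ` ?W \<noteq> {}" using zero_fvec by blast
  have "ent_fun (lin_pmf d bas) \<alpha> = entropy_pmf (map_pmf g (pmf_of_set ?W))"
    unfolding ent_fun_def lin_pmf_def map_pmf_comp g_def by simp
  also have "\<dots> = log 2 (card (g ` ?W))"
    unfolding dot_image_uniform(1)[where g = g, OF T g] by (rule entropy_pmf_of_set) (use ne in auto)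
  also have "\<dots> = log 2 (real CARD('q) ^ vs.dim (vs.span ?T))"
    using dot_image_uniform(2)[where g = g, OF T g] by simp
  also have "\<dots> = log 2 CARD('q) * vs.dim (vs.span ?T)"
    using two_le_card_field[where 'q='q] by (subst log_nat_power) auto
  finally show ?thesis .
qed

lemma rv_lin_pmf:
  fixes bas :: "'n \<Rightarrow> (nat \<Rightarrow> 'q::{field,finite}) list"
  assumes "set (bas f) \<subseteq> fvec d"
  shows "rv (lin_pmf d bas) f = pmf_of_set ((\<lambda>x. map (\<lambda>b. dot d b x) (bas f)) ` fvec d)"
    and "card ((\<lambda>x. map (\<lambda>b. dot d b x) (bas f)) ` fvec d) = CARD('q) ^ vs.dim (vs.span (set (bas f)))"
proof -
  define g where "g x = map (\<lambda>b. dot d b x) (bas f)" for x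
  have g: "g x = g y \<longleftrightarrow> (\<forall>b\<in>set (bas f). dot d b x = dot d b y)" for x y
    unfolding g_def by auto
  have "rv (lin_pmf d bas) f = map_pmf g (pmf_of_set (fvec d))"
    unfolding rv_def lin_pmf_def map_pmf_comp g_def by simp
  then show "rv (lin_pmf d bas) f = pmf_of_set ((\<lambda>x. map (\<lambda>b. dot d b x) (bas f)) ` fvec d)"
    using dot_image_uniform(1)[where g = g, OF assms g] unfolding g_def by simp
  show "card ((\<lambda>x. map (\<lambda>b. dot d b x) (bas f)) ` fvec d) = CARD('q) ^ vs.dim (vs.span (set (bas f)))"
    using dot_image_uniform(2)[where g = g, OF assms g] unfolding g_def by simp
qed

lemma set_rv_lin_pmf:
  assumes "set (bas f) \<subseteq> fvec d"
  shows "set_pmf (rv (lin_pmf d bas) f) = (\<lambda>x. map (\<lambda>b. dot d b x) (bas f)) ` fvec d"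
proof -
  have "fvec d \<noteq> ({} :: (nat \<Rightarrow> 'a) set)" using zero_fvec by blast
  then show ?thesis by (simp add: rv_lin_pmf(1)[of bas f d, OF assms])
qed

lemma log_supp_size_lin_pmf:
  fixes bas :: "'n \<Rightarrow> (nat \<Rightarrow> 'q::{field,finite}) list"
  assumes "set (bas f) \<subseteq> fvec d"
  shows "log 2 (supp_size (lin_pmf d bas) f) = log 2 CARD('q) * vs.dim (vs.span (set (bas f)))"
proof -
  have "real (supp_size (lin_pmf d bas) f) = real CARD('q) ^ vs.dim (vs.span (set (bas f)))"
    unfolding supp_size_def set_rv_lin_pmf[of bas f d, OF assms] rv_lin_pmf(2)[of bas f d, OF assms] by simp
  then show ?thesis using two_le_card_field[where 'q='q] by (simp add: log_nat_power del: vs.dim_span)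
qed

text \<open>Independent generators without repetition give as many values as there are lists of that
  length, so every list occurs. This supplies the uniform row vectors required of sources and
  keys.\<close>

lemma rv_lin_pmf_independent:
  fixes bas :: "'n \<Rightarrow> (nat \<Rightarrow> 'q::{field,finite}) list"
  assumes "set (bas f) \<subseteq> fvec d" "vs.independent (set (bas f))" "distinct (bas f)"
  shows "rv (lin_pmf d bas) f = pmf_of_set {xs. length xs = length (bas f)}"
proof -
  let ?g = "\<lambda>x. map (\<lambda>b. dot d b x) (bas f)"
  have eq: "{xs :: 'q list. length xs = length (bas f)} = {xs. set xs \<subseteq> UNIV \<and> length xs = length (bas f)}" by simp
  have "vs.dim (vs.span (set (bas f))) = length (bas f)"
    using vs.dim_span_eq_card_independent[OF assms(2)] assms(3) by (simp only: distinct_card)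
  then have "card (?g ` fvec d) = card {xs :: 'q list. length xs = length (bas f)}"
    using rv_lin_pmf(2)[of bas f d, OF assms(1)] unfolding eq
    by (subst card_lists_length_eq) (simp_all del: vs.dim_span)
  moreover have "finite {xs :: 'q list. length xs = length (bas f)}"
    unfolding eq by (rule finite_lists_length_eq) simp
  ultimately have "?g ` fvec d = {xs. length xs = length (bas f)}"
    by (intro card_subset_eq) auto
  then show ?thesis using rv_lin_pmf(1)[of bas f d, OF assms(1)] by simp
qed

lemma dot_sum: "dot d (\<Sum>i\<in>I. v i) x = (\<Sum>i\<in>I. dot d (v i) x)"
  by (induction I rule: infinite_finite_induct) (simp_all only: sum.infinite sum.empty sum.insert dot_simps not_False_eq_True)

lemma dot_unit: "j < d \<Longrightarrow> dot d (\<lambda>i. if i = j then 1 else 0) x = x j"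
  by (simp add: dot_def if_distrib[of "\<lambda>a. a * _"] cong: if_cong)

section \<open>From codes to representable functions\<close>

lemma ent_fun_singleton: "ent_fun Pr {f} = entropy_pmf (rv Pr f)"
proof -
  have "ent_fun Pr {f} = entropy_pmf (map_pmf (\<lambda>l g. if g = f then l else []) (rv Pr f))"
    unfolding ent_fun_def rv_def map_pmf_comp by (rule arg_cong[where f = entropy_pmf], rule map_pmf_cong) auto
  also have "\<dots> = entropy_pmf (rv Pr f)"
    by (rule entropy_map_inj) (auto intro!: inj_onI dest: fun_cong[where x = f])
  finally show ?thesis .
qed

section \<open>Order of the links along the network\<close>

definition link_rel :: "'n sncp \<Rightarrow> ('n \<times> 'n) set" where
  "link_rel P = {(f, e). f \<in> lnks P \<and> e \<in> lnks P \<and> tl P e \<in> hd P f}"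

lemma wf_node_rel:
  assumes "sec_problem P"
  shows "wf (node_rel P)"
proof (rule finite_acyclic_wf)
  have "node_rel P \<subseteq> nods P \<times> nods P" using assms by (auto simp: node_rel_def sec_problem_def)
  then show "finite (node_rel P)" using assms by (auto simp: sec_problem_def intro: finite_subset)
  show "acyclic (node_rel P)" using assms by (simp add: sec_problem_def)
qed

text \<open>The tail of a link fed by \<open>f\<close> lies in the head of \<open>f\<close>, so
  passing to tails sends \<open>link_rel\<close> into \<open>node_rel\<close>.\<close>

lemma wf_link_rel:
  assumes "sec_problem P"
  shows "wf (link_rel P)"
  by (rule wf_subset[OF wf_inv_image[OF wf_node_rel[OF assms], of "tl P"]])
    (auto simp: link_rel_def inv_image_def node_rel_def)

lemma problem_disjoint:
  assumes "sec_problem P"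
  shows "e \<in> lnks P \<Longrightarrow> e \<notin> srcs P" "e \<in> lnks P \<Longrightarrow> e \<notin> nods P" "u \<in> nods P \<Longrightarrow> u \<notin> srcs P"
    "e \<in> lnks P \<Longrightarrow> tl P e \<in> nods P" "u \<in> nods P \<Longrightarrow> u \<notin> lnks P" "u \<in> srcs P \<Longrightarrow> u \<notin> lnks P"
    "u \<in> srcs P \<Longrightarrow> u \<notin> nods P"
  using assms by (auto simp: sec_problem_def)

text \<open>Prepares the inductions along the network: sources and keys are the base cases, all
  other inputs fall under the induction hypothesis.\<close>

lemma in_edge_cases:
  assumes "sec_problem P" "e \<in> lnks P" "f \<in> in_edge P e \<union> {tl P e}"
  shows "f \<in> srcs P \<union> nods P \<or> (f, e) \<in> link_rel P"
proof -
  have "hd' P f = hd P f" if "f \<in> lnks P" using that assms(1) by (auto simp: hd'_def sec_problem_def)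
  then show ?thesis using assms by (auto simp: in_edge_def link_rel_def sec_problem_def)
qed

text \<open>Each source and key vector is uniform, and by \<open>C_I\<close> their joint entropy is
  the logarithm of the size of the product of their alphabets. Hence they are jointly uniform, and
  listing all their entries turns them into one uniform vector. Links follow by induction along the
  network, since a linear map of scalar products is again a list of scalar products.\<close>

lemma q_linear_code_is_lin_pmf:
  fixes Pr :: "('n \<Rightarrow> 'q::{field,finite} list) pmf"
  assumes P: "sec_problem P" and code: "q_linear_code TYPE('q) P Pr"
  shows "\<exists>d bas. (\<forall>f. set (bas f) \<subseteq> fvec d) \<and> Pr = lin_pmf d bas"
proof -
  define F where "F = srcs P \<union> nods P"
  have finF: "finite F" and disj: "srcs P \<inter> nods P = {}" using P by (auto simp: F_def sec_problem_def)
  have sc: "stoch_code P Pr" using code by (simp add: q_linear_code_def)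
  have "\<forall>f\<in>F. \<exists>k. rv Pr f = pmf_of_set {xs. length xs = k}"
    using code by (simp add: q_linear_code_def F_def)
  then obtain k where k: "\<And>f. f \<in> F \<Longrightarrow> rv Pr f = pmf_of_set {xs. length xs = k f}" by metis
  have Leq: "{xs :: 'q list. length xs = n} = {xs. set xs \<subseteq> UNIV \<and> length xs = n}" for n by simp
  have finL: "finite {xs :: 'q list. length xs = n}" for n
    unfolding Leq by (rule finite_lists_length_eq) simp
  have cardL: "card {xs :: 'q list. length xs = n} = CARD('q) ^ n" for n
    unfolding Leq by (rule card_lists_length_eq) simp
  have neL: "{xs :: 'q list. length xs = n} \<noteq> {}" for n
    using Ex_list_of_length[of n] by blast
  have len: "length (y f) = k f" if "y \<in> set_pmf Pr" "f \<in> F" for y f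
  proof -
    have "y f \<in> set_pmf (rv Pr f)" using that by (auto simp: rv_def)
    then show ?thesis using k[OF that(2)] finL neL by simp
  qed
  \<comment> \<open>The default \<open>[]\<close> outside \<open>F\<close> agrees with the masking
    in \<open>ent_fun\<close>, so that masked assignments lie in \<open>A\<close>.\<close>
  define A where "A = PiE_dflt F [] (\<lambda>f. {xs :: 'q list. length xs = k f})"
  have finA: "finite A" unfolding A_def using finF finL by (intro finite_PiE_dflt)
  have cardA: "card A = (\<Prod>f\<in>F. CARD('q) ^ k f)"
    unfolding A_def using finF finL by (simp add: card_PiE_dflt cardL)
  define \<rho> where "\<rho> y = (\<lambda>f. if f \<in> F then y f else [])" for y :: "'n \<Rightarrow> 'q list"
  have "entropy_pmf (map_pmf \<rho> Pr) = log 2 (card A)"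
  proof -
    have "entropy_pmf (map_pmf \<rho> Pr) = ent_fun Pr F" unfolding ent_fun_def \<rho>_def ..
    also have "\<dots> = (\<Sum>s\<in>srcs P. ent_fun Pr {s}) + (\<Sum>u\<in>nods P. ent_fun Pr {u})"
      using sc by (simp add: stoch_code_def C_I_def F_def)
    also have "\<dots> = (\<Sum>f\<in>F. ent_fun Pr {f})"
      unfolding F_def using finF disj by (subst sum.union_disjoint) (auto simp: F_def)
    also have "\<dots> = (\<Sum>f\<in>F. log 2 (real (CARD('q) ^ k f)))"
      using finL neL by (intro sum.cong refl) (simp add: ent_fun_singleton k entropy_pmf_of_set cardL)
    also have "\<dots> = log 2 (\<Prod>f\<in>F. real (CARD('q) ^ k f))"
      unfolding log_def using finF by (subst ln_prod) (auto simp: sum_divide_distrib)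
    finally show ?thesis unfolding cardA by simp
  qed
  moreover have "set_pmf (map_pmf \<rho> Pr) \<subseteq> A"
    using len by (auto simp: A_def PiE_dflt_def \<rho>_def)
  ultimately have unifA: "map_pmf \<rho> Pr = pmf_of_set A" using finA by (intro entropy_max_imp_uniform) auto
  have neA: "A \<noteq> {}" using \<open>set_pmf (map_pmf \<rho> Pr) \<subseteq> A\<close> set_pmf_not_empty[of "map_pmf \<rho> Pr"] by blast

  \<comment> \<open>\<open>Z\<close> indexes the single entries of all source and key vectors; the
    bijection \<open>p\<close> numbers them as coordinates of \<open>fvec d\<close>.\<close>
  define Z where "Z = Sigma F (\<lambda>f. {..<k f})"
  define d where "d = card Z"
  have "finite Z" unfolding Z_def using finF by simp
  then obtain p where p: "bij_betw p Z {0..<d}" using ex_bij_betw_finite_nat unfolding d_def by blast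
  define p' where "p' = the_inv_into Z p"
  have p'p: "p' (p z) = z" if "z \<in> Z" for z
    unfolding p'_def using p that by (simp add: bij_betw_def the_inv_into_f_f)
  have pd: "p z < d" if "z \<in> Z" for z using p that by (auto simp: bij_betw_def)
  have p'Z: "p' j \<in> Z" and pp': "p (p' j) = j" if "j < d" for j
    using bij_betw_the_inv_into[OF p] f_the_inv_into_f_bij_betw[OF p, of j] that
    unfolding p'_def by (auto simp: bij_betw_def)
  define enc where "enc y = (\<lambda>j. if j < d then y (fst (p' j)) ! snd (p' j) else (0 :: 'q))" for y
  have enc_nth: "enc y (p (f, i)) = y f ! i" if "f \<in> F" "i < k f" for y f i
    using that pd[of "(f, i)"] p'p[of "(f, i)"] by (simp add: enc_def Z_def)
  have enc\<rho>: "enc (\<rho> y) = enc y" for y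
    using p'Z by (fastforce simp: enc_def \<rho>_def Z_def fun_eq_iff)
  have "inj_on enc A"
  proof (rule inj_onI)
    fix y y' assume y: "y \<in> A" "y' \<in> A" and eq: "enc y = enc y'"
    show "y = y'"
    proof
      fix f show "y f = y' f"
      proof (cases "f \<in> F")
        case True
        then have "length (y f) = k f" "length (y' f) = k f" using y by (auto simp: A_def PiE_dflt_def)
        then show ?thesis using enc_nth[OF True, of _ y] enc_nth[OF True, of _ y'] eq
          by (metis nth_equalityI)
      next
        case False
        then show ?thesis using y by (auto simp: A_def PiE_dflt_def)
      qed
    qed
  qed
  moreover have "enc ` A = fvec d"
  proof (intro set_eqI iffI)
    fix x :: "nat \<Rightarrow> 'q" assume x: "x \<in> fvec d"
    define y where "y f = (if f \<in> F then map (\<lambda>i. x (p (f, i))) [0..<k f] else [])" for f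
    have "enc y = x"
    proof
      fix j show "enc y j = x j"
      proof (cases "j < d")
        case True
        then have "fst (p' j) \<in> F" "snd (p' j) < k (fst (p' j))" using p'Z[OF True] by (auto simp: Z_def)
        then show ?thesis using True pp' by (simp add: enc_def y_def)
      qed (use x in \<open>simp add: enc_def fvec_def\<close>)
    qed
    moreover have "y \<in> A" by (auto simp: A_def PiE_dflt_def y_def)
    ultimately show "x \<in> enc ` A" by blast
  qed (auto simp: enc_def fvec_def)
  ultimately have "map_pmf enc (pmf_of_set A) = pmf_of_set (fvec d)"
    using finA neA by (simp add: map_pmf_of_set_inj)
  then have encPr: "map_pmf enc Pr = pmf_of_set (fvec d)"
    using unifA enc\<rho> by (metis (no_types, lifting) map_pmf_comp map_pmf_cong)

  define good where "good f bs \<longleftrightarrow> set bs \<subseteq> fvec d \<and> (\<forall>y\<in>set_pmf Pr. y f = map (\<lambda>b. dot d b (enc y)) bs)" for f bs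
  have goodF: "\<exists>bs. good f bs" if f: "f \<in> F" for f
  proof
    have "\<forall>i<k f. p (f, i) < d" using pd f by (auto simp: Z_def)
    \<comment> \<open>Entry \<open>i\<close> of \<open>f\<close> is coordinate
      \<open>p (f, i)\<close> of the encoded vector, hence its product with that unit
      vector.\<close>
    then show "good f (map (\<lambda>i j. if j = p (f, i) then 1 else 0) [0..<k f])"
      unfolding good_def using f len
      by (auto simp: fvec_def enc_nth dot_unit intro!: nth_equalityI)
  qed
  have goodE: "e \<in> lnks P \<longrightarrow> (\<exists>bs. good e bs)" for e
  proof (induction e rule: wf_induct_rule[OF wf_link_rel[OF P]])
    case (1 e)
    show ?case
    proof
      assume e: "e \<in> lnks P"
      let ?I = "in_edge P e \<union> {tl P e}"
      have "\<exists>bs. good f bs" if "f \<in> ?I" for f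
        using in_edge_cases[OF P e that] goodF 1 by (auto simp: F_def link_rel_def)
      then obtain bs where bs: "\<And>f. f \<in> ?I \<Longrightarrow> good f (bs f)" by metis
      obtain m and c :: "nat \<Rightarrow> 'n \<Rightarrow> nat \<Rightarrow> 'q" where c: "\<And>y. y \<in> set_pmf Pr \<Longrightarrow>
        y e = map (\<lambda>j. \<Sum>f\<in>?I. \<Sum>i<length (y f). c j f i * (y f ! i)) [0..<m]"
        using code e unfolding q_linear_code_def by blast
      \<comment> \<open>Row \<open>j\<close> of the matrix, applied to the generators of the inputs
        instead of their values, gives the generator for entry \<open>j\<close> of
        \<open>y e\<close>.\<close>
      define v where "v j = (\<Sum>f\<in>?I. \<Sum>i<length (bs f). vscale (c j f i) (bs f ! i))" for j
      have "v j \<in> fvec d" for j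
        unfolding v_def
      proof (intro vs.subspace_sum[OF subspace_fvec] vs.subspace_scale[OF subspace_fvec])
        fix f i assume "f \<in> ?I" "i \<in> {..<length (bs f)}"
        then show "bs f ! i \<in> fvec d" using bs[of f] nth_mem[of i "bs f"] unfolding good_def by blast
      qed
      moreover have "y e = map (\<lambda>b. dot d b (enc y)) (map v [0..<m])" if y: "y \<in> set_pmf Pr" for y
      proof -
        have "(\<Sum>f\<in>?I. \<Sum>i<length (y f). c j f i * (y f ! i)) = dot d (v j) (enc y)" for j
          unfolding v_def dot_sum
        proof (rule sum.cong[OF refl])
          fix f assume "f \<in> ?I"
          then have yf: "y f = map (\<lambda>b. dot d b (enc y)) (bs f)" using bs y by (auto simp: good_def)
          show "(\<Sum>i<length (y f). c j f i * y f ! i) = (\<Sum>i<length (bs f). dot d (vscale (c j f i) (bs f ! i)) (enc y))"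
            unfolding dot_simps by (intro sum.cong) (simp_all add: yf)
        qed
        then show ?thesis using c[OF y] by simp
      qed
      ultimately have "good e (map v [0..<m])" unfolding good_def by auto
      then show "\<exists>bs. good e bs" by blast
    qed
  qed
  \<comment> \<open>Outside the index set a code takes the value \<open>[]\<close>, so the empty
    list of generators fits.\<close>
  have out: "good f []" if "f \<notin> idx P" for f
    using sc that by (auto simp: good_def stoch_code_def)
  have "\<exists>bs. good f bs" for f
    using goodF[of f] goodE[of f] out[of f] by (auto simp: idx_def F_def)
  then obtain bas where bas: "\<And>f. good f (bas f)" by metis
  have "lin_pmf d bas = map_pmf (\<lambda>y f. map (\<lambda>b. dot d b (enc y)) (bas f)) Pr"
    unfolding lin_pmf_def encPr[symmetric] map_pmf_comp ..
  also have "\<dots> = map_pmf (\<lambda>y. y) Pr"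
  proof (rule map_pmf_cong[OF refl], rule ext)
    fix y f assume "y \<in> set_pmf Pr"
    then show "map (\<lambda>b. dot d b (enc y)) (bas f) = y f" using bas[of f] by (simp add: good_def)
  qed
  finally have "Pr = lin_pmf d bas" by simp
  moreover have "\<forall>f. set (bas f) \<subseteq> fvec d" using bas by (simp add: good_def)
  ultimately show ?thesis by blast
qed

text \<open>Dividing by log q turns entropies into dimensions of spans, so the function is weakly
  representable, and a constant sequence makes it almost representable.\<close>

lemma lin_pmf_Ups_bar:
  fixes bas :: "'n \<Rightarrow> (nat \<Rightarrow> 'q::{field,finite}) list"
  assumes bas: "\<And>f. set (bas f) \<subseteq> fvec d"
  shows "ent_fun (lin_pmf d bas) \<in> Ups_bar TYPE('q) P"
proof -
  let ?h = "ent_fun (lin_pmf d bas)"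
  have pos: "log 2 CARD('q) > 0" using two_le_card_field[where 'q='q] by simp
  have "q_representable TYPE('q) (idx P) (\<lambda>\<alpha>. (1 / log 2 CARD('q)) * ?h \<alpha>)"
    unfolding q_representable_def
  proof (intro exI[of _ d] exI[of _ "\<lambda>f. vs.span (set (bas f))"] conjI ballI allI impI)
    show "vs.span (set (bas i)) \<subseteq> {v. \<forall>j\<ge>d. v j = 0}" for i
      using span_subset_fvec[OF bas] by (simp add: fvec_def)
    show "1 / log 2 CARD('q) * ?h \<alpha> = real (vs.dim (vs.span (\<Union>f\<in>\<alpha>. vs.span (set (bas f)))))" for \<alpha>
      using pos unfolding span_UN_span ent_fun_lin_pmf[OF bas]
      by (simp only: times_divide_eq_left mult_1_left nonzero_mult_div_cancel_left less_irrefl mult.assoc)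
  qed simp
  then have "weakly_q_representable TYPE('q) (idx P) ?h"
    unfolding weakly_q_representable_def using pos by (intro exI[of _ "1 / log 2 CARD('q)"]) simp
  then show ?thesis unfolding Ups_bar_def almost_q_representable_def
    by (intro CollectI exI[of _ "\<lambda>_. ?h"]) simp
qed

text \<open>The entropy functions of the codes themselves supply the tuples, with the same scaling
  factors. Uniformity on the support makes the logarithm of a support size equal to the entropy of
  that variable.\<close>

lemma achievable_imp_CL:
  fixes P :: "'n sncp"
  assumes P: "sec_problem P" and ach: "achievable_qlin_ss TYPE('q::{field,finite}) P lam om"
  shows "(lam, om) \<in> CL P (proj ` (Ups_bar TYPE('q) P \<inter> C_I P \<inter> C_T P \<inter> C_D P \<inter> C_S P))"
proof -
  obtain Y :: "nat \<Rightarrow> ('n \<Rightarrow> 'q list) pmf" and c where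
    code: "\<And>n. q_linear_code TYPE('q) P (Y n)" and c: "\<And>n. c n > 0" and
    e: "\<forall>e\<in>lnks P. \<exists>L. (\<lambda>n. c n * log 2 (supp_size (Y n) e)) \<longlonglongrightarrow> L \<and> L \<le> om e" and
    s: "\<forall>s\<in>srcs P. \<exists>L. (\<lambda>n. c n * log 2 (supp_size (Y n) s)) \<longlonglongrightarrow> L \<and> L \<ge> lam s" and
    D: "\<And>n. \<forall>s\<in>srcs P. \<forall>u\<in>dest P s. condh (ent_fun (Y n)) {s} (in_node P u) = 0" and
    S: "\<And>n. \<forall>(A,B)\<in>wtap P. meeth (ent_fun (Y n)) A B = 0"
    using ach unfolding achievable_qlin_ss_def by blast
  have lin: "ent_fun (Y n) \<in> Ups_bar TYPE('q) P \<and> (\<forall>f. log 2 (supp_size (Y n) f) = ent_fun (Y n) {f})" for n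
  proof -
    obtain d bas where "\<And>f. set (bas f) \<subseteq> fvec d" "Y n = lin_pmf d bas"
      using q_linear_code_is_lin_pmf[OF P code[of n]] by blast
    then show ?thesis using lin_pmf_Ups_bar[of bas d P]
      by (simp add: log_supp_size_lin_pmf ent_fun_lin_pmf)
  qed
  let ?t = "\<lambda>n. proj (ent_fun (Y n))"
  have "?t n \<in> proj ` (Ups_bar TYPE('q) P \<inter> C_I P \<inter> C_T P \<inter> C_D P \<inter> C_S P)" for n
    using lin[of n] code[of n] D[of n] S[of n]
    by (intro imageI) (auto simp: q_linear_code_def stoch_code_def C_D_def C_S_def)
  then show ?thesis unfolding CL_def using c e s lin
    by (intro CollectI case_prodI exI[of _ ?t] exI[of _ c]) (auto simp: proj_def)
qed

section \<open>Repairing approximate solutions\<close>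

lemma finite_subset_fvec: "S \<subseteq> fvec d \<Longrightarrow> finite (S :: (nat \<Rightarrow> 'q::{field,finite}) set)"
  using finite_subset finite_fvec by blast

text \<open>Enlarging the sum of the \<open>U i\<close> by \<open>Y\<close> costs at most
  \<epsilon>, hence enlarging the sum of the smaller \<open>W i\<close> by \<open>X\<close> costs at
  most \<epsilon> plus what the \<open>W i\<close> lost. By the dimension formula this cost is the
  codimension of the intersection in \<open>X\<close>. It bounds the losses both at links and at
  sinks.\<close>

lemma dim_Int_loss:
  fixes U W :: "'i \<Rightarrow> (nat \<Rightarrow> 'q::{field,finite}) set"
  assumes I: "finite I" and U: "\<And>i. i \<in> I \<Longrightarrow> vs.subspace (U i) \<and> U i \<subseteq> fvec d"
    and W: "\<And>i. i \<in> I \<Longrightarrow> vs.subspace (W i) \<and> W i \<subseteq> U i"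
    and X: "vs.subspace X" "X \<subseteq> Y" "Y \<subseteq> fvec d"
    and le: "real (vs.dim (vs.span (Y \<union> ssum U I))) - vs.dim (ssum U I) \<le> \<epsilon>"
  shows "real (vs.dim X) - vs.dim (X \<inter> ssum W I) \<le> \<epsilon> + (\<Sum>i\<in>I. real (vs.dim (U i)) - vs.dim (W i))"
proof -
  have TU: "ssum U I \<subseteq> fvec d" using U by (intro ssum_subset_fvec) auto
  have WU: "ssum W I \<subseteq> ssum U I" using W by (intro ssum_mono) auto
  have fin: "finite (ssum W I)" "finite X" "finite (vs.span (Y \<union> ssum U I))"
    using TU WU X span_subset_fvec[of "Y \<union> ssum U I" d] by (auto intro!: finite_subset_fvec[of _ d])
  have "vs.dim (vs.span (X \<union> ssum W I)) \<le> vs.dim (vs.span (Y \<union> ssum U I))"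
    using fin X(2) WU by (intro dim_mono vs.span_mono) auto
  moreover have "vs.dim (vs.span (X \<union> ssum W I)) + vs.dim (X \<inter> ssum W I) = vs.dim X + vs.dim (ssum W I)"
    using fin X(1) by (intro dim_sum_Int) auto
  moreover have "vs.dim (ssum U I) \<le> vs.dim (ssum W I) + (\<Sum>i\<in>I. vs.dim (U i) - vs.dim (W i))"
    using I U W by (intro dim_ssum_loss[where d = d]) auto
  moreover have "real (\<Sum>i\<in>I. vs.dim (U i) - vs.dim (W i)) = (\<Sum>i\<in>I. real (vs.dim (U i)) - vs.dim (W i))"
    unfolding of_nat_sum
  proof (rule sum.cong[OF refl])
    fix i assume "i \<in> I"
    then have "vs.dim (W i) \<le> vs.dim (U i)"
      using U[of i] W[of i] finite_subset_fvec[of "U i" d] by (intro dim_mono) auto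
    then show "real (vs.dim (U i) - vs.dim (W i)) = real (vs.dim (U i)) - vs.dim (W i)" by simp
  qed
  ultimately show ?thesis using le by linarith
qed

text \<open>Codimensions in \<open>X\<close> are subadditive under intersection, because the span of
  two subspaces of \<open>X\<close> stays inside \<open>X\<close>.\<close>

lemma dim_INT_loss:
  fixes X :: "(nat \<Rightarrow> 'q::{field,finite}) set"
  assumes Q: "finite Q" and X: "vs.subspace X" "finite X" and T: "\<And>u. u \<in> Q \<Longrightarrow> vs.subspace (T u)"
  shows "vs.subspace (X \<inter> (\<Inter>u\<in>Q. T u)) \<and>
    real (vs.dim X) - vs.dim (X \<inter> (\<Inter>u\<in>Q. T u)) \<le> (\<Sum>u\<in>Q. real (vs.dim X) - vs.dim (X \<inter> T u))"
  using Q T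
proof (induction Q rule: finite_induct)
  case empty
  then show ?case using X by simp
next
  case (insert u Q)
  let ?Y = "X \<inter> (\<Inter>u\<in>Q. T u)" and ?Z = "X \<inter> T u"
  have Y: "vs.subspace ?Y" and Z: "vs.subspace ?Z" using insert X by (auto intro: vs.subspace_inter)
  have eq: "X \<inter> (\<Inter>u\<in>insert u Q. T u) = ?Y \<inter> ?Z" by auto
  have "vs.dim (vs.span (?Y \<union> ?Z)) + vs.dim (?Y \<inter> ?Z) = vs.dim ?Y + vs.dim ?Z"
    using Y Z X(2) by (intro dim_sum_Int) auto
  moreover have "vs.span (?Y \<union> ?Z) \<subseteq> X" using X(1) by (intro vs.span_minimal) auto
  then have "vs.dim (vs.span (?Y \<union> ?Z)) \<le> vs.dim X" using X by (intro dim_mono) auto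
  ultimately have "real (vs.dim X) - vs.dim (?Y \<inter> ?Z) \<le> (real (vs.dim X) - vs.dim ?Y) + (real (vs.dim X) - vs.dim ?Z)"
    by linarith
  also have "\<dots> \<le> (\<Sum>u\<in>Q. real (vs.dim X) - vs.dim (X \<inter> T u)) + (real (vs.dim X) - vs.dim ?Z)"
    using insert by simp
  finally show ?case unfolding eq using insert Y Z by (simp add: vs.subspace_inter)
qed

text \<open>A basis of the sum is chosen inside the union, and each basis vector is assigned to one
  member that contains it. The total dimension given up is then exactly the defect of independence
  of the family.\<close>

lemma independent_refinement:
  fixes U :: "'i \<Rightarrow> (nat \<Rightarrow> 'q::{field,finite}) set"
  assumes F: "finite F" and U: "\<And>f. f \<in> F \<Longrightarrow> vs.subspace (U f) \<and> U f \<subseteq> fvec d"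
  shows "\<exists>B. (\<forall>f. finite (B f)) \<and> (\<forall>f\<in>F. B f \<subseteq> U f) \<and> vs.independent (\<Union>f\<in>F. B f) \<and>
    (\<forall>f g. f \<noteq> g \<longrightarrow> B f \<inter> B g = {}) \<and> vs.dim (ssum U F) = (\<Sum>f\<in>F. card (B f))"
proof -
  obtain B where B: "B \<subseteq> (\<Union>f\<in>F. U f)" "vs.independent B" "(\<Union>f\<in>F. U f) \<subseteq> vs.span B" "card B = vs.dim (\<Union>f\<in>F. U f)"
    using vs.basis_exists by blast
  have "\<forall>b\<in>B. \<exists>f\<in>F. b \<in> U f" using B(1) by blast
  then obtain \<phi> where \<phi>: "\<And>b. b \<in> B \<Longrightarrow> \<phi> b \<in> F \<and> b \<in> U (\<phi> b)" by metis
  define Bf where "Bf f = {b\<in>B. \<phi> b = f}" for f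
  have finB: "finite B" using B(1) U by (intro finite_subset_fvec[of _ d]) blast
  have UB: "(\<Union>f\<in>F. Bf f) = B" using \<phi> by (auto simp: Bf_def)
  have "card B = card (\<Union>f\<in>F. Bf f)" using UB by simp
  also have "\<dots> = (\<Sum>f\<in>F. card (Bf f))"
    using F finB by (intro card_UN_disjoint) (auto simp: Bf_def)
  finally have "vs.dim (ssum U F) = (\<Sum>f\<in>F. card (Bf f))"
    using B(4) unfolding ssum_def by simp
  moreover have "\<forall>f\<in>F. Bf f \<subseteq> U f" using \<phi> by (auto simp: Bf_def)
  moreover have "\<forall>f. finite (Bf f)" using finB by (simp add: Bf_def)
  moreover have "\<forall>f g. f \<noteq> g \<longrightarrow> Bf f \<inter> Bf g = {}" by (auto simp: Bf_def)
  ultimately show ?thesis using B(2) UB by metis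
qed

text \<open>\<open>U\<close> supplies the link spaces to be cut down, \<open>V\<close> the final source and key spaces.\<close>

definition link_space :: "'n sncp \<Rightarrow> ('n \<Rightarrow> (nat \<Rightarrow> 'q::field) set) \<Rightarrow> ('n \<Rightarrow> (nat \<Rightarrow> 'q) set) \<Rightarrow> 'n \<Rightarrow> (nat \<Rightarrow> 'q) set" where
  "link_space P U V = wfrec (link_rel P)
     (\<lambda>W e. U e \<inter> ssum (\<lambda>f. if f \<in> lnks P then W f else V f) (in_edge P e \<union> {tl P e}))"

definition net_space :: "'n sncp \<Rightarrow> ('n \<Rightarrow> (nat \<Rightarrow> 'q::field) set) \<Rightarrow> ('n \<Rightarrow> (nat \<Rightarrow> 'q) set) \<Rightarrow> 'n \<Rightarrow> (nat \<Rightarrow> 'q) set" where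
  "net_space P U V f = (if f \<in> lnks P then link_space P U V f else V f)"

text \<open>Well-founded recursion sees only links preceding \<open>e\<close>; this is no
  restriction, since all links among the inputs of \<open>e\<close> do precede it.\<close>

lemma net_space_link:
  assumes P: "sec_problem P" and e: "e \<in> lnks P"
  shows "net_space P U V e = U e \<inter> ssum (net_space P U V) (in_edge P e \<union> {tl P e})"
proof -
  let ?W = "link_space P U V" and ?I = "in_edge P e \<union> {tl P e}"
  have "?W e = U e \<inter> ssum (\<lambda>f. if f \<in> lnks P then cut ?W (link_rel P) e f else V f) ?I"
    unfolding link_space_def by (subst wfrec[OF wf_link_rel[OF P]]) simp
  also have "ssum (\<lambda>f. if f \<in> lnks P then cut ?W (link_rel P) e f else V f) ?I = ssum (net_space P U V) ?I"
  proof (rule ssum_cong)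
    fix f assume f: "f \<in> ?I"
    have "(f, e) \<in> link_rel P" if "f \<in> lnks P"
      using in_edge_cases[OF P e f] that P by (auto simp: sec_problem_def)
    then show "(if f \<in> lnks P then cut ?W (link_rel P) e f else V f) = net_space P U V f"
      by (simp add: net_space_def cut_apply)
  qed
  finally show ?thesis using e by (simp add: net_space_def)
qed

section \<open>The constraints on subspaces, with and without defect\<close>

text \<open>The bounds say how far the constraints of \<open>C_I\<close>, \<open>C_T\<close>,
  \<open>C_D\<close> and \<open>C_S\<close>, in this order, may be violated, measured in
  dimensions.\<close>

definition approx_spaces :: "'n sncp \<Rightarrow> nat \<Rightarrow> ('n \<Rightarrow> (nat \<Rightarrow> 'q::{field,finite}) set) \<Rightarrow> real \<Rightarrow> bool" where
  "approx_spaces P d U \<epsilon> \<longleftrightarrow>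
     (\<forall>f\<in>idx P. vs.subspace (U f) \<and> U f \<subseteq> fvec d) \<and>
     (\<Sum>f\<in>srcs P \<union> nods P. real (vs.dim (U f))) - vs.dim (ssum U (srcs P \<union> nods P)) \<le> \<epsilon> \<and>
     (\<forall>e\<in>lnks P. real (vs.dim (ssum U ({e} \<union> (in_edge P e \<union> {tl P e})))) - vs.dim (ssum U (in_edge P e \<union> {tl P e})) \<le> \<epsilon>) \<and>
     (\<forall>s\<in>srcs P. \<forall>u\<in>dest P s. real (vs.dim (ssum U ({s} \<union> in_node P u))) - vs.dim (ssum U (in_node P u)) \<le> \<epsilon>) \<and>
     (\<forall>(A,B)\<in>wtap P. real (vs.dim (ssum U A)) + vs.dim (ssum U B) - vs.dim (ssum U (A \<union> B)) \<le> \<epsilon>)"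

text \<open>For subspaces, zero conditional rank is an inclusion and zero meet is a trivial
  intersection.\<close>

definition exact_spaces :: "'n sncp \<Rightarrow> nat \<Rightarrow> ('n \<Rightarrow> (nat \<Rightarrow> 'q::{field,finite}) set) \<Rightarrow> bool" where
  "exact_spaces P d U \<longleftrightarrow>
     (\<forall>f\<in>idx P. vs.subspace (U f) \<and> U f \<subseteq> fvec d) \<and>
     vs.dim (ssum U (srcs P \<union> nods P)) = (\<Sum>f\<in>srcs P \<union> nods P. vs.dim (U f)) \<and>
     (\<forall>e\<in>lnks P. U e \<subseteq> ssum U (in_edge P e \<union> {tl P e})) \<and>
     (\<forall>s\<in>srcs P. \<forall>u\<in>dest P s. U s \<subseteq> ssum U (in_node P u)) \<and>
     (\<forall>(A,B)\<in>wtap P. ssum U A \<inter> ssum U B = {0})"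

lemma problem_subsets:
  assumes "sec_problem P"
  shows "e \<in> lnks P \<Longrightarrow> in_edge P e \<union> {tl P e} \<subseteq> idx P" "in_node P u \<subseteq> idx P" "finite (idx P)"
    "finite (in_edge P e)" "finite (in_node P u)"
  using assms by (auto simp: sec_problem_def idx_def in_edge_def in_node_def)

definition refines :: "'n sncp \<Rightarrow> ('n \<Rightarrow> (nat \<Rightarrow> 'q::{field,finite}) set) \<Rightarrow> ('n \<Rightarrow> (nat \<Rightarrow> 'q) set) \<Rightarrow> real \<Rightarrow> bool" where
  "refines P U V \<epsilon> \<longleftrightarrow> (\<forall>f\<in>srcs P \<union> nods P. vs.subspace (V f) \<and> V f \<subseteq> U f \<and> real (vs.dim (U f)) - vs.dim (V f) \<le> \<epsilon>)"

lemma net_space_sub: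
  assumes P: "sec_problem P" and ap: "approx_spaces P d U \<epsilon>" and V: "refines P U V \<epsilon>" and f: "f \<in> idx P"
  shows "vs.subspace (net_space P U V f) \<and> net_space P U V f \<subseteq> U f \<and> net_space P U V f \<subseteq> fvec d"
proof (cases "f \<in> lnks P")
  case True
  then show ?thesis using ap f net_space_link[OF P True, of U V]
    by (auto simp: approx_spaces_def intro: vs.subspace_inter)
next
  case False
  then have "f \<in> srcs P \<union> nods P" using f by (auto simp: idx_def)
  then show ?thesis using False ap V f by (auto simp: approx_spaces_def net_space_def refines_def)
qed

text \<open>The constants come before the spaces and the defect, so they depend on the network
  alone. Along the network, a link loses at most one \<epsilon> for its own defect and in addition
  what its inputs have lost.\<close>

lemma net_space_loss:
  assumes P: "sec_problem P"
  shows "\<exists>C. \<forall>f. 0 \<le> C f \<and> (f \<in> idx P \<longrightarrow> (\<forall>d (U :: 'n \<Rightarrow> (nat \<Rightarrow> 'q::{field,finite}) set) V \<epsilon>.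
    approx_spaces P d U \<epsilon> \<longrightarrow> refines P U V \<epsilon> \<longrightarrow> real (vs.dim (U f)) - vs.dim (net_space P U V f) \<le> C f * \<epsilon>))"
proof -
  define ok where "ok f C \<longleftrightarrow> (\<forall>d (U :: 'n \<Rightarrow> (nat \<Rightarrow> 'q::{field,finite}) set) V \<epsilon>.
    approx_spaces P d U \<epsilon> \<longrightarrow> refines P U V \<epsilon> \<longrightarrow> real (vs.dim (U f)) - vs.dim (net_space P U V f) \<le> C * \<epsilon>)" for f C
  have okF: "ok f 1" if "f \<in> srcs P \<union> nods P" for f
  proof -
    have "f \<notin> lnks P" using that P by (auto simp: sec_problem_def)
    then show ?thesis using that by (auto simp: ok_def refines_def net_space_def)
  qed
  have okE: "e \<in> lnks P \<longrightarrow> (\<exists>C\<ge>0. ok e C)" for e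
  proof (induction e rule: wf_induct_rule[OF wf_link_rel[OF P]])
    case (1 e)
    show ?case
    proof
      assume e: "e \<in> lnks P"
      let ?I = "in_edge P e \<union> {tl P e}"
      have "\<exists>C\<ge>0. ok f C" if "f \<in> ?I" for f
        using in_edge_cases[OF P e that]
      proof
        assume "f \<in> srcs P \<union> nods P"
        then show ?thesis using okF zero_le_one by blast
      next
        assume "(f, e) \<in> link_rel P"
        then show ?thesis using 1[of f] by (simp add: link_rel_def)
      qed
      then obtain C where C: "\<And>f. f \<in> ?I \<Longrightarrow> 0 \<le> C f \<and> ok f (C f)" by metis
      have "ok e (1 + (\<Sum>f\<in>?I. C f))" unfolding ok_def
      proof (intro allI impI)
        fix d and U V :: "'n \<Rightarrow> (nat \<Rightarrow> 'q::{field,finite}) set" and \<epsilon>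
        assume ap: "approx_spaces P d U \<epsilon>" and V: "refines P U V \<epsilon>"
        let ?W = "net_space P U V"
        have sub: "vs.subspace (U f) \<and> U f \<subseteq> fvec d \<and> vs.subspace (?W f) \<and> ?W f \<subseteq> U f" if "f \<in> idx P" for f
          using net_space_sub[OF P ap V that] ap that by (auto simp: approx_spaces_def)
        have eI: "e \<in> idx P" "?I \<subseteq> idx P" using e problem_subsets(1)[OF P e] by (auto simp: idx_def)
        have un: "vs.span (U e \<union> ssum U ?I) = ssum U ({e} \<union> ?I)"
          unfolding ssum_Un[of U "{e}"] using sub[OF eI(1)] by (simp add: ssum_singleton)
        have "real (vs.dim (U e)) - vs.dim (U e \<inter> ssum ?W ?I) \<le> \<epsilon> + (\<Sum>f\<in>?I. real (vs.dim (U f)) - vs.dim (?W f))"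
        proof (rule dim_Int_loss[where d = d])
          show "finite ?I" using problem_subsets(4)[OF P] by simp
          show "real (vs.dim (vs.span (U e \<union> ssum U ?I))) - vs.dim (ssum U ?I) \<le> \<epsilon>"
            unfolding un using ap e by (simp add: approx_spaces_def)
        qed (use sub eI in auto)
        also have "(\<Sum>f\<in>?I. real (vs.dim (U f)) - vs.dim (?W f)) \<le> (\<Sum>f\<in>?I. C f * \<epsilon>)"
          using C ap V by (intro sum_mono) (auto simp: ok_def)
        finally show "real (vs.dim (U e)) - vs.dim (?W e) \<le> (1 + (\<Sum>f\<in>?I. C f)) * \<epsilon>"
          unfolding net_space_link[OF P e, of U V] by (simp add: algebra_simps sum_distrib_left)
      qed
      moreover have "0 \<le> 1 + (\<Sum>f\<in>?I. C f)" using C sum_nonneg[of ?I C] by simp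
      ultimately show "\<exists>C\<ge>0. ok e C" by blast
    qed
  qed
  have "\<exists>C\<ge>0. f \<in> idx P \<longrightarrow> ok f C" for f
    using okE[of f] okF[of f] zero_le_one[where 'a=real] unfolding idx_def by blast
  then have "\<forall>f. \<exists>C. 0 \<le> C \<and> (f \<in> idx P \<longrightarrow> ok f C)" by blast
  then show ?thesis unfolding ok_def by (rule choice)
qed

section \<open>Sources available at a node and links entering it\<close>

text \<open>A source available at \<open>u\<close> has \<open>u\<close> as its only origin. If it
  were an input of a link whose tail leads to \<open>u\<close>, that tail would be \<open>u\<close>
  itself and close a directed cycle. So upstream of \<open>u\<close> only other sources and keys
  contribute.\<close>

lemma upstream_avoids_source:
  assumes P: "sec_problem P" and O1: "\<forall>s\<in>srcs P. card (orig P s) = 1"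
  shows "e \<in> lnks P \<longrightarrow> (tl P e, u) \<in> (node_rel P)\<^sup>+ \<longrightarrow>
    net_space P U V e \<subseteq> ssum (net_space P U V) (srcs P \<union> nods P - in_node P u)"
proof (induction e rule: wf_induct_rule[OF wf_link_rel[OF P]])
  case (1 e)
  show ?case
  proof (intro impI)
    assume e: "e \<in> lnks P" and r: "(tl P e, u) \<in> (node_rel P)\<^sup>+"
    let ?W = "net_space P U V" and ?I = "in_edge P e \<union> {tl P e}" and ?J = "srcs P \<union> nods P - in_node P u"
    have "?W f \<subseteq> ssum ?W ?J" if f: "f \<in> ?I" for f
    proof -
      consider "f \<in> srcs P" "f \<in> in_edge P e" | "f \<in> nods P" "f = tl P e" | "(f, e) \<in> link_rel P"
        using in_edge_cases[OF P e f] f problem_disjoint(3,5)[OF P, of f] problem_disjoint(4)[OF P e]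
        by (auto simp: in_edge_def)
      then show ?thesis
      proof cases
        case 1
        then have t: "tl P e \<in> orig P f" by (simp add: in_edge_def hd'_def)
        have "u \<notin> orig P f"
        proof
          assume "u \<in> orig P f"
          then have "u = tl P e" using t O1 1(1) by (metis card_1_singletonE singletonD)
          then show False using r P by (auto simp: sec_problem_def acyclic_def)
        qed
        then have "f \<in> ?J" using 1 by (auto simp: in_node_def hd'_def)
        then show ?thesis by (rule in_ssum)
      next
        case 2
        then have "f \<in> ?J" using problem_disjoint(3,5)[OF P, of f] by (auto simp: in_node_def)
        then show ?thesis by (rule in_ssum)
      next
        case 3
        then have "(tl P f, tl P e) \<in> node_rel P" by (auto simp: link_rel_def node_rel_def)
        then have "(tl P f, u) \<in> (node_rel P)\<^sup>+" using r by (rule trancl_into_trancl2)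
        then show ?thesis using "1.IH"[OF 3] 3 by (simp add: link_rel_def)
      qed
    qed
    then have "ssum ?W ?I \<subseteq> ssum ?W ?J" by (intro ssum_minimal) auto
    then show "?W e \<subseteq> ssum ?W ?J" using net_space_link[OF P e, of U V] by blast
  qed
qed

text \<open>An internal direct sum, carried by a basis that is split among the members; dimensions
  add up and disjoint subfamilies meet trivially.\<close>

locale independent_spaces =
  fixes F :: "'i set" and W :: "'i \<Rightarrow> (nat \<Rightarrow> 'q::{field,finite}) set" and B :: "'i \<Rightarrow> (nat \<Rightarrow> 'q) set"
  assumes finF: "finite F" and finB: "\<And>f. finite (B f)" and ind: "vs.independent (\<Union>f\<in>F. B f)"
    and disj: "\<And>f g. f \<noteq> g \<Longrightarrow> B f \<inter> B g = {}" and W: "\<And>f. f \<in> F \<Longrightarrow> W f = vs.span (B f)"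
begin

lemma ssum_eq: "A \<subseteq> F \<Longrightarrow> ssum W A = vs.span (\<Union>f\<in>A. B f)"
proof (rule subset_antisym)
  assume A: "A \<subseteq> F"
  show "ssum W A \<subseteq> vs.span (\<Union>f\<in>A. B f)"
  proof (rule ssum_minimal)
    fix f assume f: "f \<in> A"
    then show "W f \<subseteq> vs.span (\<Union>f\<in>A. B f)" using A W[of f] vs.span_mono[of "B f" "\<Union>f\<in>A. B f"] by auto
  qed simp
  show "vs.span (\<Union>f\<in>A. B f) \<subseteq> ssum W A"
  proof (rule vs.span_minimal)
    show "(\<Union>f\<in>A. B f) \<subseteq> ssum W A"
    proof (rule UN_least)
      fix f assume f: "f \<in> A"
      then have "B f \<subseteq> W f" using A W[of f] vs.span_superset by auto
      then show "B f \<subseteq> ssum W A" using in_ssum[OF f, of W] by blast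
    qed
  qed simp
qed

lemma dim_W: "f \<in> F \<Longrightarrow> vs.dim (W f) = card (B f)"
proof -
  assume f: "f \<in> F"
  have "vs.independent (B f)" by (rule vs.independent_mono[OF ind]) (use f in auto)
  then show ?thesis using W[OF f] vs.dim_span_eq_card_independent[of "B f"] by simp
qed

lemma dim_ssum: "A \<subseteq> F \<Longrightarrow> vs.dim (ssum W A) = (\<Sum>f\<in>A. vs.dim (W f))"
proof -
  assume A: "A \<subseteq> F"
  have "vs.dim (ssum W A) = card (\<Union>f\<in>A. B f)"
    unfolding ssum_eq[OF A] using A
    by (intro vs.dim_span_eq_card_independent vs.independent_mono[OF ind]) blast
  also have "\<dots> = (\<Sum>f\<in>A. card (B f))"
    using finF finB disj A finite_subset by (intro card_UN_disjoint) auto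
  also have "\<dots> = (\<Sum>f\<in>A. vs.dim (W f))" using dim_W A by (intro sum.cong) auto
  finally show ?thesis .
qed

lemma ssum_Int: "A \<subseteq> F \<Longrightarrow> A' \<subseteq> F \<Longrightarrow> A \<inter> A' = {} \<Longrightarrow> ssum W A \<inter> ssum W A' = {0}"
proof -
  assume A: "A \<subseteq> F" "A' \<subseteq> F" "A \<inter> A' = {}"
  have fin: "finite A" "finite A'" using A(1,2) finF finite_subset by blast+
  show ?thesis unfolding ssum_eq[OF A(1)] ssum_eq[OF A(2)]
  proof (rule span_Int_independent)
    show "vs.independent (\<Union> (B ` A) \<union> \<Union> (B ` A'))"
      using A by (intro vs.independent_mono[OF ind]) blast
    show "\<Union> (B ` A) \<inter> \<Union> (B ` A') = {}"
    proof (rule equals0I)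
      fix b assume "b \<in> \<Union> (B ` A) \<inter> \<Union> (B ` A')"
      then obtain f g where fg: "f \<in> A" "g \<in> A'" "b \<in> B f \<inter> B g" by blast
      then have "f \<noteq> g" using A(3) by blast
      then show False using disj[of f g] fg(3) by simp
    qed
  qed (use fin finB in auto)
qed

end

text \<open>Write a vector of the left side as \<open>z + y\<close> with \<open>z\<close> from the
  links into \<open>u\<close> and \<open>y\<close> from the sources available at \<open>u\<close>.
  Both the vector and \<open>z\<close> lie in the sum of the other sources and keys, so
  \<open>y\<close> does too, and directness forces \<open>y = 0\<close>.\<close>

lemma link_inputs_suffice:
  fixes U V :: "'n \<Rightarrow> (nat \<Rightarrow> 'q::{field,finite}) set"
  assumes P: "sec_problem P" and O1: "\<forall>s\<in>srcs P. card (orig P s) = 1"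
    and ind: "independent_spaces (srcs P \<union> nods P) (net_space P U V) B"
    and s: "s \<in> srcs P" "s \<notin> in_node P u"
  shows "net_space P U V s \<inter> ssum (net_space P U V) (in_node P u)
    \<subseteq> ssum (net_space P U V) (in_node P u \<inter> lnks P)"
proof
  let ?W = "net_space P U V" and ?N = "in_node P u" and ?F = "srcs P \<union> nods P"
  fix x assume x: "x \<in> ?W s \<inter> ssum ?W ?N"
  have N: "?N = (?N \<inter> lnks P) \<union> (?N \<inter> srcs P)" by (auto simp: in_node_def)
  have "x \<in> vs.span (ssum ?W (?N \<inter> lnks P) \<union> ssum ?W (?N \<inter> srcs P))"
    using x ssum_Un[of ?W "?N \<inter> lnks P" "?N \<inter> srcs P"] N by simp
  then obtain z y where zy: "z \<in> ssum ?W (?N \<inter> lnks P)" "y \<in> ssum ?W (?N \<inter> srcs P)" "x = z + y"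
    unfolding vs.span_Un[of "ssum ?W (?N \<inter> lnks P)"] by (auto simp: vs.span_eq_iff[THEN iffD2])
  have "ssum ?W (?N \<inter> lnks P) \<subseteq> ssum ?W (?F - ?N)"
  proof (rule ssum_minimal)
    fix e assume e: "e \<in> ?N \<inter> lnks P"
    then have "u \<in> hd P e" using problem_disjoint(1)[OF P, of e] by (auto simp: in_node_def hd'_def)
    then have "(tl P e, u) \<in> (node_rel P)\<^sup>+" using e by (auto simp: node_rel_def)
    then show "?W e \<subseteq> ssum ?W (?F - ?N)" using upstream_avoids_source[OF P O1, of e u U V] e by blast
  qed simp
  then have z: "z \<in> ssum ?W (?F - ?N)" using zy(1) by blast
  have "x \<in> ssum ?W (?F - ?N)" using x in_ssum[of s "?F - ?N" ?W] s by blast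
  then have "y \<in> ssum ?W (?F - ?N)"
    using zy(3) z vs.subspace_diff[of "ssum ?W (?F - ?N)" x z] by simp
  moreover have "ssum ?W (?F - ?N) \<inter> ssum ?W (?N \<inter> srcs P) = {0}"
    by (rule independent_spaces.ssum_Int[OF ind]) auto
  ultimately have "y = 0" using zy(2) by blast
  then show "x \<in> ssum ?W (?N \<inter> lnks P)" using zy by simp
qed

section \<open>Splitting the sources and repairing the constraints\<close>

lemma complement:
  fixes S K :: "(nat \<Rightarrow> 'q::{field,finite}) set"
  assumes "vs.subspace S" "finite S" "vs.subspace K" "K \<subseteq> S"
  shows "\<exists>C. vs.subspace C \<and> C \<subseteq> S \<and> C \<inter> K = {0} \<and> vs.dim C + vs.dim K = vs.dim S"
  using subspace_complement[of S K "{0}"] assms vs.subspace_0[of S] vs.subspace_0[of K]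
  by auto

text \<open>\<open>M\<close> stands for what all sinks decode, \<open>R0\<close> for what
  adversaries learn. First \<open>X\<close> is chosen in \<open>M\<close> as a complement of
  \<open>M \<inter> R0\<close>; it then meets \<open>R0\<close> trivially, so a complement
  \<open>R\<close> of \<open>X\<close> in \<open>W\<close> can be chosen around \<open>R0\<close>.
  The loss against \<open>M\<close> is at most the dimension of \<open>R0\<close>.\<close>

lemma source_split:
  fixes W R0 M :: "(nat \<Rightarrow> 'q::{field,finite}) set"
  assumes W: "vs.subspace W" "finite W" and R0: "vs.subspace R0" "R0 \<subseteq> W" and M: "vs.subspace M" "M \<subseteq> W"
  shows "\<exists>X R. vs.subspace X \<and> X \<subseteq> M \<and> vs.subspace R \<and> R0 \<subseteq> R \<and> R \<subseteq> W \<and> vs.span (R \<union> X) = W \<and>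
    vs.dim R + vs.dim X = vs.dim W \<and> vs.dim M \<le> vs.dim X + vs.dim R0"
proof -
  have fin: "finite R0" "finite M" using assms finite_subset by blast+
  obtain X where X: "vs.subspace X" "X \<subseteq> M" "X \<inter> (M \<inter> R0) = {0}" "vs.dim X + vs.dim (M \<inter> R0) = vs.dim M"
    using complement[of M "M \<inter> R0"] M R0 fin vs.subspace_inter[of M R0] by auto
  have "vs.dim (M \<inter> R0) \<le> vs.dim R0" using M R0 fin by (intro dim_mono vs.subspace_inter) auto
  moreover have "X \<inter> R0 = {0}" using X(2,3) by blast
  then obtain R where "vs.subspace R" "R0 \<subseteq> R" "R \<subseteq> W" "vs.span (R \<union> X) = W" "vs.dim R + vs.dim X = vs.dim W"
    using subspace_complement[OF W X(1) R0(2,1) order_trans[OF X(2) M(2)]] by metis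
  ultimately have "vs.subspace X \<and> X \<subseteq> M \<and> vs.subspace R \<and> R0 \<subseteq> R \<and> R \<subseteq> W \<and> vs.span (R \<union> X) = W \<and>
    vs.dim R + vs.dim X = vs.dim W \<and> vs.dim M \<le> vs.dim X + vs.dim R0"
    using X(1,2,4) by simp
  then show ?thesis by (intro exI)
qed

text \<open>Every stage loses at most a multiple of \<epsilon> fixed by the network: the choice of
  bases for sources and keys, the cut of the links, the sinks, and the adversaries. From the sinks
  on, the link spaces stay untouched.\<close>

lemma exact_refinement:
  fixes P :: "'n sncp"
  assumes P: "sec_problem P" and O1: "\<forall>s\<in>srcs P. card (orig P s) = 1"
  shows "\<exists>C\<ge>0. \<forall>d (U :: 'n \<Rightarrow> (nat \<Rightarrow> 'q::{field,finite}) set) \<epsilon>. approx_spaces P d U \<epsilon> \<longrightarrow> 0 \<le> \<epsilon> \<longrightarrow>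
    (\<exists>U' :: 'n \<Rightarrow> (nat \<Rightarrow> 'q) set. exact_spaces P d U' \<and> (\<forall>f\<in>srcs P \<union> lnks P. \<bar>real (vs.dim (U f)) - vs.dim (U' f)\<bar> \<le> C * \<epsilon>))"
proof -
  let ?F = "srcs P \<union> nods P"
  obtain C where "\<forall>f. 0 \<le> C f \<and> (f \<in> idx P \<longrightarrow> (\<forall>d (U :: 'n \<Rightarrow> (nat \<Rightarrow> 'q::{field,finite}) set) V \<epsilon>.
    approx_spaces P d U \<epsilon> \<longrightarrow> refines P U V \<epsilon> \<longrightarrow> real (vs.dim (U f)) - vs.dim (net_space P U V f) \<le> C f * \<epsilon>))"
    using net_space_loss[OF P] by (rule exE)
  then have C0: "\<And>f. 0 \<le> C f" and C: "\<And>f d (U :: 'n \<Rightarrow> (nat \<Rightarrow> 'q::{field,finite}) set) V \<epsilon>.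
      f \<in> idx P \<Longrightarrow> approx_spaces P d U \<epsilon> \<Longrightarrow> refines P U V \<epsilon> \<Longrightarrow>
      real (vs.dim (U f)) - vs.dim (net_space P U V f) \<le> C f * \<epsilon>"
    by simp_all
  \<comment> \<open>At a sink where \<open>s\<close> itself is available decoding is automatic, so
    only the remaining sinks cost anything.\<close>
  define Q where "Q s = {u\<in>dest P s. s \<notin> in_node P u}" for s
  \<comment> \<open>For a source the summands pay for the choice of bases, for each remaining sink
    and for each adversary; a link loses only in the cut.\<close>
  define C' where "C' f = (if f \<in> srcs P
    then C f + (\<Sum>u\<in>Q f. 1 + (\<Sum>g\<in>in_node P u. C g)) + card (wtap P) else C f)" for f
  have C'0: "0 \<le> C' f" for f unfolding C'_def using C0 by (auto intro!: sum_nonneg add_nonneg_nonneg)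
  have finP: "finite (srcs P)" "finite (lnks P)" "finite (nods P)" "finite (wtap P)"
    using P by (auto simp: sec_problem_def)
  have finQ: "finite (Q s)" if "s \<in> srcs P" for s
    using P that finite_subset[of "dest P s" "nods P"] by (auto simp: sec_problem_def Q_def)
  have wt: "A \<subseteq> srcs P \<and> B \<subseteq> lnks P" if "(A, B) \<in> wtap P" for A B
    using P that by (auto simp: sec_problem_def)
  show ?thesis
  proof (intro exI[of _ "\<Sum>f\<in>srcs P \<union> lnks P. C' f"] conjI allI impI)
    show "0 \<le> (\<Sum>f\<in>srcs P \<union> lnks P. C' f)" using C'0 by (simp add: sum_nonneg)
    fix d and U :: "'n \<Rightarrow> (nat \<Rightarrow> 'q) set" and \<epsilon>
    assume ap: "approx_spaces P d U \<epsilon>" and \<epsilon>0: "0 \<le> \<epsilon>"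
    have U: "vs.subspace (U f) \<and> U f \<subseteq> fvec d" if "f \<in> idx P" for f
      using ap that by (auto simp: approx_spaces_def)
    have UF: "vs.subspace (U f) \<and> U f \<subseteq> fvec d" if "f \<in> ?F" for f
      using U[of f] that by (auto simp: idx_def)
    have "finite ?F" using finP by simp
    then have "\<exists>B. (\<forall>f. finite (B f)) \<and> (\<forall>f\<in>?F. B f \<subseteq> U f) \<and>
        vs.independent (\<Union>f\<in>?F. B f) \<and> (\<forall>f g. f \<noteq> g \<longrightarrow> B f \<inter> B g = {}) \<and> vs.dim (ssum U ?F) = (\<Sum>f\<in>?F. card (B f))"
      by (rule independent_refinement) (rule UF)
    then obtain B where "(\<forall>f. finite (B f)) \<and> (\<forall>f\<in>?F. B f \<subseteq> U f) \<and>
        vs.independent (\<Union>f\<in>?F. B f) \<and> (\<forall>f g. f \<noteq> g \<longrightarrow> B f \<inter> B g = {}) \<and> vs.dim (ssum U ?F) = (\<Sum>f\<in>?F. card (B f))"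
      by (elim exE)
    then have B: "\<And>f. finite (B f)" "\<And>f. f \<in> ?F \<Longrightarrow> B f \<subseteq> U f" "vs.independent (\<Union>f\<in>?F. B f)"
      "\<And>f g. f \<noteq> g \<Longrightarrow> B f \<inter> B g = {}" "vs.dim (ssum U ?F) = (\<Sum>f\<in>?F. card (B f))"
      by simp_all
    define V where "V f = vs.span (B f)" for f
    define W where "W = net_space P U V"
    have WF: "W f = vs.span (B f)" if "f \<in> ?F" for f
      using that problem_disjoint(5,6)[OF P, of f] by (auto simp: W_def net_space_def V_def)
    interpret independent_spaces ?F W B
      by unfold_locales (use \<open>finite ?F\<close> B WF in auto)
    have VU: "V f \<subseteq> U f" if "f \<in> ?F" for f
      unfolding V_def using UF[OF that] B(2)[OF that] by (intro vs.span_minimal) auto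
    have V: "refines P U V \<epsilon>" unfolding refines_def
    proof (intro ballI conjI)
      fix f assume f: "f \<in> ?F"
      show "vs.subspace (V f)" by (simp add: V_def)
      show "V f \<subseteq> U f" using VU[OF f] .
      have dV: "vs.dim (V g) = card (B g)" if "g \<in> ?F" for g
        using dim_W[OF that] WF[OF that] by (simp add: V_def)
      have nn: "0 \<le> real (vs.dim (U g)) - vs.dim (V g)" if "g \<in> ?F" for g
      proof -
        have "vs.dim (V g) \<le> vs.dim (U g)"
          using VU[OF that] UF[OF that] finite_subset_fvec[of "U g" d] by (intro dim_mono) (auto simp: V_def)
        then show ?thesis by simp
      qed
      \<comment> \<open>All losses are nonnegative, so a single one is at most their sum, which is
        the defect of \<open>C_I\<close>.\<close>
      have "real (vs.dim (U f)) - vs.dim (V f) \<le> (\<Sum>g\<in>?F. real (vs.dim (U g)) - vs.dim (V g))"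
        using f nn \<open>finite ?F\<close> by (intro member_le_sum) auto
      also have "\<dots> = (\<Sum>g\<in>?F. real (vs.dim (U g))) - (\<Sum>g\<in>?F. real (card (B g)))"
        unfolding sum_subtractf using dV by simp
      also have "\<dots> = (\<Sum>g\<in>?F. real (vs.dim (U g))) - vs.dim (ssum U ?F)" using B(5) by simp
      also have "\<dots> \<le> \<epsilon>" using ap by (simp add: approx_spaces_def)
      finally show "real (vs.dim (U f)) - vs.dim (V f) \<le> \<epsilon>" .
    qed
    have Ws: "vs.subspace (W f)" "W f \<subseteq> U f" "W f \<subseteq> fvec d" "finite (W f)" if "f \<in> idx P" for f
      using net_space_sub[OF P ap V that] finite_subset_fvec[of "W f" d] unfolding W_def by auto
    have Wloss: "real (vs.dim (U f)) - vs.dim (W f) \<le> C f * \<epsilon>" if "f \<in> idx P" for f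
      unfolding W_def using C[OF that ap V] .
    have src: "f \<in> idx P" if "f \<in> srcs P" for f using that by (simp add: idx_def)
    have lnk: "f \<in> idx P" if "f \<in> lnks P" for f using that by (simp add: idx_def)

    \<comment> \<open>\<open>M s\<close> is what all sinks in \<open>Q s\<close> decode from links
      only. The restriction to links keeps it decodable when the source spaces shrink later.\<close>
    define M where "M s = W s \<inter> (\<Inter>u\<in>Q s. ssum W (in_node P u \<inter> lnks P))" for s
    have M: "vs.subspace (M s)" "real (vs.dim (W s)) - vs.dim (M s) \<le> (\<Sum>u\<in>Q s. 1 + (\<Sum>g\<in>in_node P u. C g)) * \<epsilon>"
      if s: "s \<in> srcs P" for s
    proof -
      have *: "vs.subspace (M s) \<and>
        real (vs.dim (W s)) - vs.dim (M s) \<le> (\<Sum>u\<in>Q s. real (vs.dim (W s)) - vs.dim (W s \<inter> ssum W (in_node P u \<inter> lnks P)))"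
        unfolding M_def using finQ[OF s] Ws[OF src[OF s]] by (intro dim_INT_loss) auto
      then show "vs.subspace (M s)" by simp
      have "real (vs.dim (W s)) - vs.dim (W s \<inter> ssum W (in_node P u \<inter> lnks P)) \<le> (1 + (\<Sum>g\<in>in_node P u. C g)) * \<epsilon>"
        if u: "u \<in> Q s" for u
      proof -
        let ?N = "in_node P u"
        have N: "?N \<subseteq> idx P" "finite ?N" using problem_subsets[OF P] by auto
        have un: "vs.span (U s \<union> ssum U ?N) = ssum U ({s} \<union> ?N)"
          unfolding ssum_Un[of U "{s}"] using U[OF src[OF s]] by (simp add: ssum_singleton)
        \<comment> \<open>The defect bound concerns decoding from all inputs of the node; the
          sources among them contribute nothing about \<open>s\<close>.\<close>
        have "W s \<inter> ssum W ?N \<subseteq> W s \<inter> ssum W (?N \<inter> lnks P)"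
          using link_inputs_suffice[OF P O1, of U V B s u] u s independent_spaces_axioms
          unfolding W_def Q_def by blast
        moreover have "W s \<inter> ssum W (?N \<inter> lnks P) \<subseteq> W s \<inter> ssum W ?N"
          using ssum_mono[of "?N \<inter> lnks P" ?N W W] by blast
        ultimately have eq: "W s \<inter> ssum W (?N \<inter> lnks P) = W s \<inter> ssum W ?N" by blast
        have "real (vs.dim (W s)) - vs.dim (W s \<inter> ssum W ?N) \<le> \<epsilon> + (\<Sum>g\<in>?N. real (vs.dim (U g)) - vs.dim (W g))"
        proof (rule dim_Int_loss[where d = d and Y = "U s"])
          show "real (vs.dim (vs.span (U s \<union> ssum U ?N))) - vs.dim (ssum U ?N) \<le> \<epsilon>"
            unfolding un using ap s u by (simp add: approx_spaces_def Q_def)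
          show "vs.subspace (U g) \<and> U g \<subseteq> fvec d" "vs.subspace (W g) \<and> W g \<subseteq> U g" if "g \<in> ?N" for g
            using U[of g] Ws[of g] N(1) that by auto
        qed (use N Ws[OF src[OF s]] U[OF src[OF s]] in auto)
        also have "(\<Sum>g\<in>?N. real (vs.dim (U g)) - vs.dim (W g)) \<le> (\<Sum>g\<in>?N. C g * \<epsilon>)"
          using Wloss N by (intro sum_mono) auto
        finally show ?thesis unfolding eq by (simp add: algebra_simps sum_distrib_left)
      qed
      then have "(\<Sum>u\<in>Q s. real (vs.dim (W s)) - vs.dim (W s \<inter> ssum W (in_node P u \<inter> lnks P)))
        \<le> (\<Sum>u\<in>Q s. (1 + (\<Sum>g\<in>in_node P u. C g)) * \<epsilon>)" by (intro sum_mono) auto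
      then show "real (vs.dim (W s)) - vs.dim (M s) \<le> (\<Sum>u\<in>Q s. 1 + (\<Sum>g\<in>in_node P u. C g)) * \<epsilon>"
        using * by (simp add: sum_distrib_right)
    qed

    have ssub: "ssum W A \<subseteq> ssum U A" "ssum U A \<subseteq> fvec d" if "A \<subseteq> idx P" for A
    proof -
      show "ssum W A \<subseteq> ssum U A" using that Ws(2) by (intro ssum_mono) auto
      show "ssum U A \<subseteq> fvec d" using that U by (intro ssum_subset_fvec) blast
    qed
    \<comment> \<open>What an adversary learns about its targets is a small space; it is spread over
      the targeted sources as subspaces of dimension at most \<epsilon> each.\<close>
    have "\<exists>R. (\<forall>s\<in>fst r. vs.subspace (R s) \<and> R s \<subseteq> W s \<and> vs.dim (R s) \<le> \<epsilon>) \<and> ssum W (fst r) \<inter> ssum W (snd r) \<subseteq> ssum R (fst r)"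
      if r: "r \<in> wtap P" for r
    proof -
      obtain A B where AB: "r = (A, B)" by (cases r)
      have sub: "A \<subseteq> srcs P" "B \<subseteq> lnks P" using wt r AB by blast+
      then have idx: "A \<subseteq> idx P" "B \<subseteq> idx P" by (auto simp: idx_def)
      let ?K = "ssum W A \<inter> ssum W B"
      have fin: "finite (ssum U A)" "finite (ssum U B)"
        using finite_subset_fvec[OF ssub(2)[OF idx(1)]] finite_subset_fvec[OF ssub(2)[OF idx(2)]] by auto
      have "?K \<subseteq> ssum U A \<inter> ssum U B" using ssub(1)[OF idx(1)] ssub(1)[OF idx(2)] by blast
      then have "vs.dim ?K \<le> vs.dim (ssum U A \<inter> ssum U B)"
        using fin by (intro dim_mono vs.subspace_inter) auto
      \<comment> \<open>By the dimension formula the intersection for \<open>U\<close> has exactly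
        the violation of \<open>C_S\<close> as its dimension.\<close>
      moreover have "vs.dim (ssum U (A \<union> B)) + vs.dim (ssum U A \<inter> ssum U B) = vs.dim (ssum U A) + vs.dim (ssum U B)"
        unfolding ssum_Un using fin by (intro dim_sum_Int) auto
      moreover have "real (vs.dim (ssum U A)) + vs.dim (ssum U B) - vs.dim (ssum U (A \<union> B)) \<le> \<epsilon>"
        using ap r AB by (auto simp: approx_spaces_def)
      ultimately have K: "real (vs.dim ?K) \<le> \<epsilon>" by linarith
      have "\<exists>R. (\<forall>i\<in>A. vs.subspace (R i) \<and> R i \<subseteq> W i \<and> vs.dim (R i) \<le> vs.dim ?K) \<and> ?K \<subseteq> ssum R A"
      proof (rule ssum_small_cover)
        show "finite A" using sub finP finite_subset by blast
        show "finite ?K" using ssub(1)[OF idx(1)] finite_subset[of ?K "ssum U A"] fin by blast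
        show "vs.subspace (W i)" if "i \<in> A" for i using Ws(1)[of i] idx that by blast
      qed simp
      then obtain R where "\<forall>i\<in>A. vs.subspace (R i) \<and> R i \<subseteq> W i \<and> vs.dim (R i) \<le> vs.dim ?K" "?K \<subseteq> ssum R A"
        by (elim exE conjE)
      moreover from this have "real (vs.dim (R i)) \<le> \<epsilon>" if "i \<in> A" for i
        using that K by (meson of_nat_mono order_trans)
      ultimately show ?thesis using AB by (intro exI[of _ R]) simp
    qed
    then obtain Rr where Rr: "\<And>r. r \<in> wtap P \<Longrightarrow>
        (\<forall>s\<in>fst r. vs.subspace (Rr r s) \<and> Rr r s \<subseteq> W s \<and> vs.dim (Rr r s) \<le> \<epsilon>) \<and>
        ssum W (fst r) \<inter> ssum W (snd r) \<subseteq> ssum (Rr r) (fst r)"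
      by metis
    \<comment> \<open>Several adversaries may target the same source, so all its leaked parts are
      added up.\<close>
    define R0 where "R0 s = ssum (\<lambda>r. Rr r s) {r\<in>wtap P. s \<in> fst r}" for s
    have R0: "vs.subspace (R0 s)" "R0 s \<subseteq> W s" "vs.dim (R0 s) \<le> card (wtap P) * \<epsilon>" if s: "s \<in> srcs P" for s
    proof -
      show "vs.subspace (R0 s)" by (simp add: R0_def)
      show "R0 s \<subseteq> W s" unfolding R0_def using Ws(1)[OF src[OF s]]
      proof (rule ssum_minimal)
        show "Rr r s \<subseteq> W s" if "r \<in> {r\<in>wtap P. s \<in> fst r}" for r using Rr[of r] that by simp
      qed
      let ?Z = "{r\<in>wtap P. s \<in> fst r}"
      have "vs.dim (R0 s) \<le> (\<Sum>r\<in>?Z. vs.dim (Rr r s))" unfolding R0_def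
      proof (rule dim_ssum_le[where d = d])
        show "Rr r s \<subseteq> fvec d" if "r \<in> ?Z" for r using Rr[of r] that Ws(3)[OF src[OF s]] by auto
        show "vs.subspace (Rr r s)" if "r \<in> ?Z" for r using Rr[of r] that by simp
      qed (use finP in simp)
      then have "real (vs.dim (R0 s)) \<le> (\<Sum>r\<in>?Z. real (vs.dim (Rr r s)))" 
        unfolding of_nat_sum[symmetric] of_nat_le_iff .
      also have "\<dots> \<le> (\<Sum>r\<in>?Z. \<epsilon>)"
      proof (rule sum_mono)
        show "real (vs.dim (Rr r s)) \<le> \<epsilon>" if "r \<in> ?Z" for r using Rr[of r] that by simp
      qed
      also have "\<dots> \<le> card (wtap P) * \<epsilon>"
        using finP card_mono[of "wtap P" ?Z] \<epsilon>0 by (auto intro!: mult_right_mono)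
      finally show "real (vs.dim (R0 s)) \<le> card (wtap P) * \<epsilon>" .
    qed

    have "\<exists>X R. vs.subspace X \<and> X \<subseteq> M s \<and> vs.subspace R \<and> R0 s \<subseteq> R \<and> R \<subseteq> W s \<and> vs.span (R \<union> X) = W s \<and>
      vs.dim R + vs.dim X = vs.dim (W s) \<and> vs.dim (M s) \<le> vs.dim X + vs.dim (R0 s)" if "s \<in> srcs P" for s
    proof (rule source_split)
      show "M s \<subseteq> W s" by (auto simp: M_def)
    qed (use Ws(1,4)[OF src[OF that]] R0(1,2)[OF that] M(1)[OF that] in auto)
    then obtain X R where XR: "\<And>s. s \<in> srcs P \<Longrightarrow> vs.subspace (X s) \<and> X s \<subseteq> M s \<and> vs.subspace (R s) \<and>
      R0 s \<subseteq> R s \<and> R s \<subseteq> W s \<and> vs.span (R s \<union> X s) = W s \<and>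
      vs.dim (R s) + vs.dim (X s) = vs.dim (W s) \<and> vs.dim (M s) \<le> vs.dim (X s) + vs.dim (R0 s)"
      by metis
    have XW: "X s \<subseteq> W s" if "s \<in> srcs P" for s using XR[OF that] by (auto simp: M_def)

    \<comment> \<open>The discarded part of a source becomes part of the key of the node offering it.\<close>
    define U' where "U' f = (if f \<in> srcs P then X f
      else if f \<in> nods P then vs.span (W f \<union> ssum R {s\<in>srcs P. f \<in> orig P s}) else W f)" for f
    have U's: "U' s = X s" if "s \<in> srcs P" for s using that by (simp add: U'_def)
    have U'v: "U' v = vs.span (W v \<union> ssum R {s\<in>srcs P. v \<in> orig P s})" if "v \<in> nods P" for v
      using that problem_disjoint(3)[OF P, of v] by (simp add: U'_def)
    have U'e: "U' e = W e" if "e \<in> lnks P" for e using that problem_disjoint(1,2)[OF P, of e] by (simp add: U'_def)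
    have Rf: "ssum R {s\<in>srcs P. v \<in> orig P s} \<subseteq> fvec d" for v
      
    proof (rule ssum_subset_fvec)
      show "R s \<subseteq> fvec d" if "s \<in> {s\<in>srcs P. v \<in> orig P s}" for s
        using that XR[of s] Ws(3)[OF src, of s] by auto
    qed
    have U': "vs.subspace (U' f) \<and> U' f \<subseteq> fvec d" if f: "f \<in> idx P" for f
    proof -
      consider "f \<in> srcs P" | "f \<in> nods P" | "f \<in> lnks P" using f by (auto simp: idx_def)
      then show ?thesis
      proof cases
        case 1
        then show ?thesis using XR[OF 1] XW[OF 1] Ws(3)[OF f] by (auto simp: U's)
      next
        case 2
        have "W f \<union> ssum R {s\<in>srcs P. f \<in> orig P s} \<subseteq> fvec d" using Ws(3)[OF f] Rf by blast
        then show ?thesis using 2 by (simp add: U'v span_subset_fvec)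
      next
        case 3
        then show ?thesis using Ws[OF f] by (auto simp: U'e)
      qed
    qed
    \<comment> \<open>The old source space is the sum of the new one and a part of the key at its
      origin, so any index set with both recovers it.\<close>
    have Wcov: "W s \<subseteq> ssum U' I" if "s \<in> srcs P" "v \<in> orig P s" "v \<in> nods P" "s \<in> I" "v \<in> I" for s v I
    proof -
      have "X s \<subseteq> ssum U' I" using in_ssum[of s I U'] that U's by auto
      moreover have "R s \<subseteq> ssum R {s\<in>srcs P. v \<in> orig P s}" using that by (intro in_ssum) auto
      then have "R s \<subseteq> U' v" unfolding U'v[OF that(3)] using vs.span_superset by blast
      then have "R s \<subseteq> ssum U' I" using in_ssum[of v I U'] that by blast
      ultimately have "vs.span (R s \<union> X s) \<subseteq> ssum U' I" by (intro vs.span_minimal) auto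
      then show ?thesis using XR[OF that(1)] by simp
    qed
    have Wv: "W v \<subseteq> ssum U' I" if "v \<in> nods P" "v \<in> I" for v I
    proof -
      have "W v \<subseteq> U' v" unfolding U'v[OF that(1)] using vs.span_superset by blast
      then show ?thesis using in_ssum[of v I U'] that by blast
    qed

    \<comment> \<open>The sum of the new spaces contains that of the old ones, whose dimension is
      the total of the old dimensions. The new total is no larger, as each \<open>R s\<close> moves
      from its source to a single key; hence equality.\<close>
    have CI: "vs.dim (ssum U' ?F) = (\<Sum>f\<in>?F. vs.dim (U' f))"
    proof (rule antisym)
      show "vs.dim (ssum U' ?F) \<le> (\<Sum>f\<in>?F. vs.dim (U' f))"
      proof (rule dim_ssum_le[where d = d])
        show "vs.subspace (U' f)" "U' f \<subseteq> fvec d" if "f \<in> ?F" for f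
          using U'[of f] that by (auto simp: idx_def)
      qed (rule \<open>finite ?F\<close>)
      have "ssum W ?F \<subseteq> ssum U' ?F"
      proof (rule ssum_minimal)
        fix f assume "f \<in> ?F"
        then consider "f \<in> nods P" | "f \<in> srcs P" by auto
        then show "W f \<subseteq> ssum U' ?F"
        proof cases
          case 2
          then obtain v where "orig P f = {v}" using O1 card_1_singletonE by metis
          moreover then have "v \<in> nods P" using P 2 by (auto simp: sec_problem_def)
          ultimately show ?thesis using 2 by (intro Wcov[of _ v]) auto
        qed (auto intro: Wv[THEN subsetD])
      qed simp
      moreover have "ssum U' ?F \<subseteq> fvec d" 
      proof (rule ssum_subset_fvec)
        show "U' f \<subseteq> fvec d" if "f \<in> ?F" for f
          using U'[of f] that by (auto simp: idx_def)
      qed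
      ultimately have "vs.dim (ssum W ?F) \<le> vs.dim (ssum U' ?F)"
        using finite_subset_fvec[of "ssum U' ?F" d] by (intro dim_mono) auto
      moreover have "(\<Sum>f\<in>?F. vs.dim (U' f)) \<le> (\<Sum>f\<in>?F. vs.dim (W f))"
      proof -
        have split: "(\<Sum>f\<in>?F. g f) = (\<Sum>s\<in>srcs P. g s) + (\<Sum>v\<in>nods P. g v)" for g :: "'n \<Rightarrow> nat"
          using P by (intro sum.union_disjoint) (auto simp: sec_problem_def)
        have "vs.dim (U' v) \<le> vs.dim (W v) + (\<Sum>s\<in>{s\<in>srcs P. v \<in> orig P s}. vs.dim (R s))" if v: "v \<in> nods P" for v
        proof -
          have vi: "v \<in> idx P" using v by (simp add: idx_def)
          have "vs.dim (U' v) \<le> vs.dim (W v) + vs.dim (ssum R {s\<in>srcs P. v \<in> orig P s})"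
            unfolding U'v[OF v] using Ws[OF vi] finite_subset_fvec[OF Rf[of v]] by (intro dim_span_Un_le) auto
          also have "vs.dim (ssum R {s\<in>srcs P. v \<in> orig P s}) \<le> (\<Sum>s\<in>{s\<in>srcs P. v \<in> orig P s}. vs.dim (R s))"
          proof (rule dim_ssum_le[where d = d])
            show "R s \<subseteq> fvec d" if "s \<in> {s\<in>srcs P. v \<in> orig P s}" for s
              using that XR[of s] Ws(3)[OF src, of s] by auto
            show "vs.subspace (R s)" if "s \<in> {s\<in>srcs P. v \<in> orig P s}" for s
              using that XR[of s] by simp
          qed (use finP in simp)
          finally show ?thesis by simp
        qed
        then have "(\<Sum>v\<in>nods P. vs.dim (U' v)) \<le> (\<Sum>v\<in>nods P. vs.dim (W v) + (\<Sum>s\<in>{s\<in>srcs P. v \<in> orig P s}. vs.dim (R s)))"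
          by (intro sum_mono) auto
        also have "\<dots> = (\<Sum>v\<in>nods P. vs.dim (W v)) + (\<Sum>s\<in>srcs P. \<Sum>v\<in>{v\<in>nods P. v \<in> orig P s}. vs.dim (R s))"
          unfolding sum.distrib using finP by (subst sum.swap_restrict) auto
        \<comment> \<open>Since \<open>orig P s\<close> is a singleton, \<open>R s\<close> is
          counted once.\<close>
        also have "(\<Sum>s\<in>srcs P. \<Sum>v\<in>{v\<in>nods P. v \<in> orig P s}. vs.dim (R s)) = (\<Sum>s\<in>srcs P. vs.dim (R s))"
        proof (rule sum.cong[OF refl])
          fix s assume s: "s \<in> srcs P"
          have "{v\<in>nods P. v \<in> orig P s} = orig P s" using s P by (auto simp: sec_problem_def)
          then show "(\<Sum>v\<in>{v\<in>nods P. v \<in> orig P s}. vs.dim (R s)) = vs.dim (R s)" using O1 s by simp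
        qed
        finally have "(\<Sum>f\<in>?F. vs.dim (U' f)) \<le> (\<Sum>s\<in>srcs P. vs.dim (X s)) + ((\<Sum>v\<in>nods P. vs.dim (W v)) + (\<Sum>s\<in>srcs P. vs.dim (R s)))"
          unfolding split using U's by simp
        also have "\<dots> = (\<Sum>s\<in>srcs P. vs.dim (R s) + vs.dim (X s)) + (\<Sum>v\<in>nods P. vs.dim (W v))"
          by (simp add: sum.distrib)
        also have "\<dots> = (\<Sum>f\<in>?F. vs.dim (W f))" unfolding split using XR by simp
        finally show ?thesis .
      qed
      ultimately show "(\<Sum>f\<in>?F. vs.dim (U' f)) \<le> vs.dim (ssum U' ?F)" using dim_ssum[of ?F] by simp
    qed

    \<comment> \<open>The link spaces are those of \<open>net_space\<close>, and the old input
      spaces are still generated: a source input has its origin at the tail, whose key holds the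
      discarded part.\<close>
    have CT: "U' e \<subseteq> ssum U' (in_edge P e \<union> {tl P e})" if e: "e \<in> lnks P" for e
    proof -
      let ?I = "in_edge P e \<union> {tl P e}"
      have "W f \<subseteq> ssum U' ?I" if f: "f \<in> ?I" for f
      proof -
        consider "f \<in> srcs P" "f \<in> in_edge P e" | "f \<in> nods P" | "f \<in> lnks P"
          using f problem_disjoint(4)[OF P e] by (auto simp: in_edge_def)
        then show ?thesis
        proof cases
          case 1
          then have "tl P e \<in> orig P f" by (simp add: in_edge_def hd'_def)
          then show ?thesis using 1 problem_disjoint(4)[OF P e] by (intro Wcov[of _ "tl P e"]) auto
        next
          case 2
          then show ?thesis using f by (rule Wv)
        next
          case 3
          then show ?thesis using in_ssum[OF f, of U'] U'e by simp
        qed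
      qed
      then have "ssum W ?I \<subseteq> ssum U' ?I" by (intro ssum_minimal) auto
      then show ?thesis using net_space_link[OF P e, of U V] unfolding U'e[OF e] W_def by blast
    qed

    have CD: "U' s \<subseteq> ssum U' (in_node P u)" if s: "s \<in> srcs P" "u \<in> dest P s" for s u
    proof (cases "s \<in> in_node P u")
      case True
      then show ?thesis by (rule in_ssum)
    next
      case False
      \<comment> \<open>\<open>X s\<close> was chosen inside sums of link spaces, and these are the
        same for \<open>U'\<close>.\<close>
      then have "X s \<subseteq> ssum W (in_node P u \<inter> lnks P)" using XR[OF s(1)] s(2) by (auto simp: M_def Q_def)
      also have "\<dots> = ssum U' (in_node P u \<inter> lnks P)" using U'e by (intro ssum_cong) auto
      also have "\<dots> \<subseteq> ssum U' (in_node P u)" by (rule ssum_mono) auto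
      finally show ?thesis using U's s by simp
    qed

    \<comment> \<open>Whatever \<open>D\<close> reveals about the old sources in \<open>A\<close>
      lies in the sum of the \<open>R s\<close>. That sum meets the sum of the \<open>X s\<close>
      trivially, so nothing is revealed about the new sources.\<close>
    have CS: "ssum U' A \<inter> ssum U' D = {0}" if AD: "(A, D) \<in> wtap P" for A D
    proof -
      have sub: "A \<subseteq> srcs P" "D \<subseteq> lnks P" using wt AD by blast+
      have finA: "finite A" using sub finP finite_subset by blast
      have 1: "ssum U' A = ssum X A" using U's sub by (intro ssum_cong) auto
      have 2: "ssum U' D = ssum W D" using U'e sub by (intro ssum_cong) auto
      have XWA: "ssum X A \<subseteq> ssum W A" using XW sub by (intro ssum_mono) blast+
      have RW: "ssum R A \<subseteq> ssum W A"
      proof (rule ssum_mono)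
        show "R s \<subseteq> W s" if "s \<in> A" for s using XR[of s] sub that by auto
      qed simp
      have WAf: "ssum W A \<subseteq> fvec d"
      proof (rule ssum_subset_fvec)
        show "W s \<subseteq> fvec d" if "s \<in> A" for s using Ws(3)[OF src, of s] sub that by auto
      qed
      have fin: "finite (ssum X A)" "finite (ssum R A)" 
        using finite_subset_fvec[of "ssum X A" d] finite_subset_fvec[of "ssum R A" d] XWA RW WAf by auto
      have "ssum W A \<inter> ssum W D \<subseteq> ssum (Rr (A, D)) A" using Rr[OF AD] by simp
      also have "\<dots> \<subseteq> ssum R A"
      proof (rule ssum_mono)
        fix s assume s: "s \<in> A"
        have "Rr (A, D) s \<subseteq> R0 s" unfolding R0_def using AD s in_ssum[of "(A, D)" "{r\<in>wtap P. s \<in> fst r}" "\<lambda>r. Rr r s"] by simp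
        then show "Rr (A, D) s \<subseteq> R s" using XR[OF subsetD[OF sub(1) s]] by auto
      qed simp
      finally have K: "ssum W A \<inter> ssum W D \<subseteq> ssum R A" .
      \<comment> \<open>Inside the direct sum of the \<open>W s\<close> the dimensions of the
        \<open>X s\<close> and \<open>R s\<close> add up to the full dimension, which leaves none
        for the intersection.\<close>
      have "vs.dim (ssum X A \<inter> ssum R A) = 0"
      proof -
        have "ssum W A \<subseteq> vs.span (ssum X A \<union> ssum R A)"
        proof (rule ssum_minimal)
          fix s assume s: "s \<in> A"
          have "vs.span (R s \<union> X s) \<subseteq> vs.span (ssum X A \<union> ssum R A)"
            using in_ssum[OF s, of X] in_ssum[OF s, of R] by (intro vs.span_mono) blast
          then show "W s \<subseteq> vs.span (ssum X A \<union> ssum R A)" using XR[of s] subsetD[OF sub(1) s] by simp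
        qed simp
        moreover have "finite (vs.span (ssum X A \<union> ssum R A))"
          using XWA RW WAf span_subset_fvec[of "ssum X A \<union> ssum R A" d]
            finite_subset_fvec[of "vs.span (ssum X A \<union> ssum R A)" d] by auto
        ultimately have "vs.dim (ssum W A) \<le> vs.dim (vs.span (ssum X A \<union> ssum R A))" by (intro dim_mono) auto
        moreover have "vs.dim (vs.span (ssum X A \<union> ssum R A)) + vs.dim (ssum X A \<inter> ssum R A) = vs.dim (ssum X A) + vs.dim (ssum R A)"
          using fin by (intro dim_sum_Int) auto
        moreover have "vs.dim (ssum X A) \<le> (\<Sum>s\<in>A. vs.dim (X s))"
        proof (rule dim_ssum_le[where d = d])
          show "X s \<subseteq> fvec d" if "s \<in> A" for s 
            using XW[OF subsetD[OF sub(1) that]] Ws(3)[OF src[OF subsetD[OF sub(1) that]]] by auto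
          show "vs.subspace (X s)" if "s \<in> A" for s using XR[OF subsetD[OF sub(1) that]] by simp
        qed (rule finA)
        moreover have "vs.dim (ssum R A) \<le> (\<Sum>s\<in>A. vs.dim (R s))"
        proof (rule dim_ssum_le[where d = d])
          show "R s \<subseteq> fvec d" if "s \<in> A" for s 
            using XR[OF subsetD[OF sub(1) that]] Ws(3)[OF src[OF subsetD[OF sub(1) that]]] by auto
          show "vs.subspace (R s)" if "s \<in> A" for s using XR[OF subsetD[OF sub(1) that]] by simp
        qed (rule finA)
        moreover have "vs.dim (ssum W A) = (\<Sum>s\<in>A. vs.dim (W s))" using sub by (intro dim_ssum) auto
        moreover have "(\<Sum>s\<in>A. vs.dim (W s)) = (\<Sum>s\<in>A. vs.dim (R s)) + (\<Sum>s\<in>A. vs.dim (X s))"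
          unfolding sum.distrib[symmetric]
        proof (rule sum.cong[OF refl])
          show "vs.dim (W s) = vs.dim (R s) + vs.dim (X s)" if "s \<in> A" for s
            using XR[OF subsetD[OF sub(1) that]] by simp
        qed
        ultimately show ?thesis by linarith
      qed
      then have "{0} = ssum X A \<inter> ssum R A"
        using fin by (intro subspace_dim_eq) (auto simp: vs.subspace_0 vs.subspace_inter)
      moreover have "ssum X A \<inter> ssum W D \<subseteq> ssum X A \<inter> ssum R A" using K XWA by blast
      moreover have "0 \<in> ssum X A \<inter> ssum W D" by (simp add: vs.subspace_0)
      ultimately show ?thesis unfolding 1 2 by blast
    qed

    have loss: "\<bar>real (vs.dim (U f)) - vs.dim (U' f)\<bar> \<le> C' f * \<epsilon>" if f: "f \<in> srcs P \<union> lnks P" for f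
    proof -
      have fi: "f \<in> idx P" using f by (auto simp: idx_def)
      have "U' f \<subseteq> U f" using f U's[of f] U'e[of f] XW[of f] Ws(2)[OF fi] by auto
      then have "vs.dim (U' f) \<le> vs.dim (U f)"
        using U'[OF fi] U[OF fi] finite_subset_fvec[of "U f" d] by (intro dim_mono) auto
      moreover have "real (vs.dim (U f)) - vs.dim (U' f) \<le> C' f * \<epsilon>"
      proof (cases "f \<in> srcs P")
        case True
        have "real (vs.dim (M f)) \<le> real (vs.dim (X f)) + vs.dim (R0 f)" using XR[OF True] by linarith
        then have "real (vs.dim (U f)) - vs.dim (X f) \<le>
            C f * \<epsilon> + (\<Sum>u\<in>Q f. 1 + (\<Sum>g\<in>in_node P u. C g)) * \<epsilon> + card (wtap P) * \<epsilon>"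
          using Wloss[OF fi] M(2)[OF True] R0(3)[OF True] by linarith
        then show ?thesis unfolding U's[OF True] using True by (simp add: C'_def algebra_simps)
      next
        case False
        then have "f \<in> lnks P" using f by simp
        then show ?thesis using False Wloss[OF fi] by (simp add: U'e C'_def)
      qed
      ultimately show ?thesis by simp
    qed
    have "\<forall>(A, D)\<in>wtap P. ssum U' A \<inter> ssum U' D = {0}" by (clarify intro!: CS)
    then have "exact_spaces P d U'" unfolding exact_spaces_def using U' CI CT CD by simp
    moreover have "\<bar>real (vs.dim (U f)) - vs.dim (U' f)\<bar> \<le> (\<Sum>f\<in>srcs P \<union> lnks P. C' f) * \<epsilon>"
      if f: "f \<in> srcs P \<union> lnks P" for f
    proof -
      have "C' f \<le> (\<Sum>f\<in>srcs P \<union> lnks P. C' f)" using f C'0 finP by (intro member_le_sum) auto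
      then show ?thesis using loss[OF f] mult_right_mono[OF _ \<epsilon>0] order_trans by blast
    qed
    ultimately show "\<exists>U' :: 'n \<Rightarrow> (nat \<Rightarrow> 'q) set. exact_spaces P d U' \<and>
      (\<forall>f\<in>srcs P \<union> lnks P. \<bar>real (vs.dim (U f)) - vs.dim (U' f)\<bar> \<le> (\<Sum>f\<in>srcs P \<union> lnks P. C' f) * \<epsilon>)"
      by (intro exI[of _ U']) simp
  qed
qed

section \<open>Codes realising exact spaces\<close>

lemma span_list_explicit:
  fixes xs :: "(nat \<Rightarrow> 'q::{field,finite}) list"
  assumes "x \<in> vs.span (set xs)" "distinct xs"
  shows "\<exists>a. x = (\<Sum>i<length xs. vscale (a i) (xs ! i))"
proof -
  obtain u where "x = (\<Sum>v\<in>set xs. vscale (u v) v)" using assms(1) vs.span_finite[of "set xs"] by auto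
  also have "\<dots> = (\<Sum>i<length xs. vscale (u (xs ! i)) (xs ! i))"
    by (rule sum.reindex_bij_betw[OF bij_betw_nth[OF assms(2) refl refl], symmetric])
  finally show ?thesis by (rule exI[of _ "\<lambda>i. u (xs ! i)"])
qed

text \<open>Taking a basis of each \<open>U f\<close> as generators in \<open>lin_pmf\<close> turns
  dimensions into entropies, so exact constraints on spaces become exact constraints on entropies.
  Bases, rather than arbitrary generators, make the source and key vectors uniform.\<close>

lemma exact_spaces_code:
  fixes P :: "'n sncp" and U :: "'n \<Rightarrow> (nat \<Rightarrow> 'q::{field,finite}) set"
  assumes P: "sec_problem P" and ex: "exact_spaces P d U"
  shows "\<exists>Pr. q_linear_code TYPE('q) P Pr \<and>
    (\<forall>s\<in>srcs P. \<forall>u\<in>dest P s. condh (ent_fun Pr) {s} (in_node P u) = 0) \<and>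
    (\<forall>(A,B)\<in>wtap P. meeth (ent_fun Pr) A B = 0) \<and>
    (\<forall>f\<in>idx P. log 2 (supp_size Pr f) = log 2 CARD('q) * vs.dim (U f))"
proof -
  let ?F = "srcs P \<union> nods P"
  define lg where "lg = log 2 (real CARD('q))"
  have U: "vs.subspace (U f)" "U f \<subseteq> fvec d" if "f \<in> idx P" for f using ex that by (auto simp: exact_spaces_def)
  have "\<exists>bs. distinct bs \<and> vs.independent (set bs) \<and> vs.span (set bs) = U f \<and> set bs \<subseteq> fvec d" if f: "f \<in> idx P" for f
  proof -
    obtain B where B: "B \<subseteq> U f" "vs.independent B" "U f \<subseteq> vs.span B" "card B = vs.dim (U f)"
      using vs.basis_exists by blast
    have sp: "vs.span B = U f" using vs.span_subspace[OF B(1,3) U(1)[OF f]] .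
    have sub: "B \<subseteq> fvec d" using B(1) U(2)[OF f] by (rule order_trans)
    obtain bs where "set bs = B" "distinct bs" using finite_distinct_list[OF finite_subset_fvec[OF sub]] by blast
    then show ?thesis using B(2) sp sub by (intro exI[of _ bs]) simp
  qed
  then obtain bs where bs: "\<And>f. f \<in> idx P \<Longrightarrow> distinct (bs f) \<and> vs.independent (set (bs f)) \<and>
      vs.span (set (bs f)) = U f \<and> set (bs f) \<subseteq> fvec d" by metis
  \<comment> \<open>No generators outside the index set, so that the code is \<open>[]\<close> there
    as \<open>stoch_code\<close> demands.\<close>
  define bas where "bas f = (if f \<in> idx P then bs f else [])" for f
  have bas: "set (bas f) \<subseteq> fvec d" for f using bs[of f] by (cases "f \<in> idx P") (simp_all add: bas_def)
  define Pr where "Pr = lin_pmf d bas"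
  have basi: "distinct (bas f)" "vs.independent (set (bas f))" "vs.span (set (bas f)) = U f" if "f \<in> idx P" for f
    using bs[OF that] that by (simp_all add: bas_def)
  have ent: "ent_fun Pr \<alpha> = lg * vs.dim (ssum U \<alpha>)" if "\<alpha> \<subseteq> idx P" for \<alpha>
  proof -
    have "ssum U \<alpha> = vs.span (\<Union>f\<in>\<alpha>. vs.span (set (bas f)))"
      unfolding ssum_def using basi(3) that by (intro arg_cong[where f = vs.span] SUP_cong) auto
    then show ?thesis unfolding Pr_def ent_fun_lin_pmf[OF bas] lg_def by (simp only: span_UN_span)
  qed
  have ent1: "ent_fun Pr {f} = lg * vs.dim (U f)" if "f \<in> idx P" for f
    using ent[of "{f}"] that ssum_singleton[of U f] U(1)[OF that] by simp
  \<comment> \<open>An absorbed space leaves the sum unchanged, which means zero conditional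
    entropy; this serves links and sinks alike.\<close>
  have absorb: "condh (ent_fun Pr) {f} I = 0" if "f \<in> idx P" "I \<subseteq> idx P" "U f \<subseteq> ssum U I" for f I
  proof -
    have "ssum U ({f} \<union> I) = ssum U I"
    proof (rule subset_antisym)
      show "ssum U ({f} \<union> I) \<subseteq> ssum U I"
      proof (rule ssum_minimal)
        show "U g \<subseteq> ssum U I" if "g \<in> {f} \<union> I" for g
          using that \<open>U f \<subseteq> ssum U I\<close> in_ssum[of g I U] by auto
      qed simp
    qed (rule ssum_mono, auto)
    then show ?thesis using ent[of "{f} \<union> I"] ent[of I] that by (simp add: condh_def)
  qed
  have ys: "\<exists>x. y = (\<lambda>f. map (\<lambda>b. dot d b x) (bas f))" if "y \<in> set_pmf Pr" for y
    using that unfolding Pr_def lin_pmf_def by auto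
  have CI: "ent_fun Pr \<in> C_I P"
  proof -
    have "ent_fun Pr ?F = lg * vs.dim (ssum U ?F)" by (rule ent) (auto simp: idx_def)
    also have "\<dots> = (\<Sum>f\<in>?F. lg * vs.dim (U f))"
      using ex by (simp add: exact_spaces_def sum_distrib_left)
    also have "\<dots> = (\<Sum>f\<in>?F. ent_fun Pr {f})" using ent1 by (intro sum.cong) (auto simp: idx_def)
    also have "\<dots> = (\<Sum>s\<in>srcs P. ent_fun Pr {s}) + (\<Sum>u\<in>nods P. ent_fun Pr {u})"
      using P by (intro sum.union_disjoint) (auto simp: sec_problem_def)
    finally show ?thesis by (simp add: C_I_def)
  qed
  have CT: "ent_fun Pr \<in> C_T P"
    unfolding C_T_def
  proof (intro CollectI ballI absorb)
    fix e assume e: "e \<in> lnks P"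
    show "e \<in> idx P" using e by (simp add: idx_def)
    show "in_edge P e \<union> {tl P e} \<subseteq> idx P" using problem_subsets(1)[OF P e] .
    show "U e \<subseteq> ssum U (in_edge P e \<union> {tl P e})" using ex e by (simp add: exact_spaces_def)
  qed
  have stoch: "stoch_code P Pr" unfolding stoch_code_def
  proof (intro conjI ballI allI impI)
    fix y f assume "y \<in> set_pmf Pr" "f \<notin> idx P"
    then show "y f = []" using ys by (force simp: bas_def)
  next
    fix f
    show "finite (set_pmf (rv Pr f))" unfolding Pr_def set_rv_lin_pmf[of bas f d, OF bas] by simp
  next
    fix s
    show "rv Pr s = pmf_of_set (set_pmf (rv Pr s))"
      unfolding Pr_def set_rv_lin_pmf[of bas s d, OF bas] by (rule rv_lin_pmf(1)[of bas s d, OF bas])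
  next
    show "ent_fun Pr \<in> C_I P \<inter> C_T P" using CI CT by simp
  qed
  have lin: "\<exists>(m::nat) (c :: nat \<Rightarrow> 'n \<Rightarrow> nat \<Rightarrow> 'q). \<forall>y\<in>set_pmf Pr.
        y e = map (\<lambda>j. \<Sum>f\<in>in_edge P e \<union> {tl P e}. \<Sum>i<length (y f). c j f i * (y f ! i)) [0..<m]"
    if e: "e \<in> lnks P" for e
  proof -
    let ?I = "in_edge P e \<union> {tl P e}"
    have ei: "e \<in> idx P" using e by (simp add: idx_def)
    have I: "?I \<subseteq> idx P" "finite ?I" using problem_subsets(1)[OF P e] problem_subsets(4)[OF P] by auto
    \<comment> \<open>A basis vector of \<open>U e\<close> lies in the sum of the input spaces.
      Expanding its components in the bases of the inputs gives the coefficients of one row of the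
      local linear map.\<close>
    have "\<exists>a. bas e ! j = (\<Sum>f\<in>?I. \<Sum>i<length (bas f). vscale (a f i) (bas f ! i))" if j: "j < length (bas e)" for j
    proof -
      have "bas e ! j \<in> vs.span (set (bas e))" using j by (intro vs.span_base) simp
      then have "bas e ! j \<in> ssum U ?I" using basi(3)[OF ei] ex e by (auto simp: exact_spaces_def)
      moreover have "vs.subspace (U f)" if "f \<in> ?I" for f using U(1) I(1) that by blast
      ultimately obtain y where y: "\<forall>f\<in>?I. y f \<in> U f" "bas e ! j = (\<Sum>f\<in>?I. y f)"
        using ssum_decompose[OF I(2), of U] by metis
      have "\<exists>a. y f = (\<Sum>i<length (bas f). vscale (a i) (bas f ! i))" if f: "f \<in> ?I" for f
      proof (rule span_list_explicit)
        have fi: "f \<in> idx P" using I(1) f by blast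
        show "y f \<in> vs.span (set (bas f))" using bspec[OF y(1) f] basi(3)[OF fi] by simp
        show "distinct (bas f)" using basi(1)[OF fi] .
      qed
      then obtain a where "\<And>f. f \<in> ?I \<Longrightarrow> y f = (\<Sum>i<length (bas f). vscale (a f i) (bas f ! i))" by metis
      then have "bas e ! j = (\<Sum>f\<in>?I. \<Sum>i<length (bas f). vscale (a f i) (bas f ! i))"
        unfolding y(2) by (rule sum.cong[OF refl])
      then show ?thesis by (rule exI[of _ a])
    qed
    then have "\<forall>j\<in>{..<length (bas e)}. \<exists>a. bas e ! j = (\<Sum>f\<in>?I. \<Sum>i<length (bas f). vscale (a f i) (bas f ! i))"
      by simp
    from bchoice[OF this] obtain c where "\<forall>j\<in>{..<length (bas e)}.
        bas e ! j = (\<Sum>f\<in>?I. \<Sum>i<length (bas f). vscale (c j f i) (bas f ! i))" by (rule exE)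
    then have c: "bas e ! j = (\<Sum>f\<in>?I. \<Sum>i<length (bas f). vscale (c j f i) (bas f ! i))"
      if "j < length (bas e)" for j using that by simp
    have "y e = map (\<lambda>j. \<Sum>f\<in>?I. \<Sum>i<length (y f). c j f i * (y f ! i)) [0..<length (bas e)]"
      if y: "y \<in> set_pmf Pr" for y
    proof -
      obtain x where x: "y = (\<lambda>f. map (\<lambda>b. dot d b x) (bas f))" using ys[OF y] by blast
      have "dot d (bas e ! j) x = (\<Sum>f\<in>?I. \<Sum>i<length (y f). c j f i * (y f ! i))" if "j < length (bas e)" for j
        unfolding c[OF that] dot_sum dot_simps x by (intro sum.cong refl) simp_all
      then show ?thesis by (intro nth_equalityI) (simp_all add: x)
    qed
    then show ?thesis by blast
  qed
  have "q_linear_code TYPE('q) P Pr" unfolding q_linear_code_def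
  proof (intro conjI ballI stoch lin)
    fix f assume "f \<in> ?F"
    then have f: "f \<in> idx P" by (auto simp: idx_def)
    show "\<exists>k. rv Pr f = pmf_of_set {xs. length xs = k}"
      unfolding Pr_def using rv_lin_pmf_independent[of bas f d, OF bas basi(2,1)[OF f]] by blast
  qed
  moreover have "condh (ent_fun Pr) {s} (in_node P u) = 0" if "s \<in> srcs P" "u \<in> dest P s" for s u
  proof (rule absorb)
    show "s \<in> idx P" using that by (simp add: idx_def)
    show "in_node P u \<subseteq> idx P" using problem_subsets(2)[OF P] .
    show "U s \<subseteq> ssum U (in_node P u)" using ex that by (simp add: exact_spaces_def)
  qed
  moreover have "meeth (ent_fun Pr) A B = 0" if AB: "(A, B) \<in> wtap P" for A B
  proof -
    have i: "A \<subseteq> idx P" "B \<subseteq> idx P" using P AB by (auto simp: sec_problem_def idx_def)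
    have fin: "finite (ssum U A)" "finite (ssum U B)"
      using finite_subset_fvec[OF ssum_subset_fvec[of A U d]] finite_subset_fvec[OF ssum_subset_fvec[of B U d]] i U(2)
      by (meson subsetD)+
    have "ssum U A \<inter> ssum U B = {0}" using ex AB by (auto simp: exact_spaces_def)
    then have "vs.dim (ssum U (A \<union> B)) = vs.dim (ssum U A) + vs.dim (ssum U B)"
      using dim_sum_Int[of "ssum U A" "ssum U B"] fin unfolding ssum_Un by simp
    then show ?thesis using ent[of A] ent[of B] ent[of "A \<union> B"] i by (simp add: meeth_def algebra_simps)
  qed
  moreover have "log 2 (supp_size Pr f) = log 2 CARD('q) * vs.dim (U f)" if "f \<in> idx P" for f
    unfolding Pr_def log_supp_size_lin_pmf[of bas f d, OF bas] basi(3)[OF that] ..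
  ultimately show ?thesis by (intro exI[of _ Pr]) auto
qed

section \<open>From representable functions to codes\<close>

text \<open>Choose a weakly representable \<open>g k\<close> near \<open>h\<close>. Its spaces, at
  scale \<open>c\<close>, violate the constraints by at most a multiple of
  \<open>c * \<delta>\<close>, the repair changes dimensions by a constant times that, and dividing
  by \<open>c\<close> brings the error below \<eta>.\<close>

lemma almost_representable_exact:
  fixes P :: "'n sncp" and h :: "'n set \<Rightarrow> real" and \<eta> :: real
  assumes P: "sec_problem P" and O1: "\<forall>s\<in>srcs P. card (orig P s) = 1"
    and h: "h \<in> Ups_bar TYPE('q::{field,finite}) P \<inter> C_I P \<inter> C_T P \<inter> C_D P \<inter> C_S P" and \<eta>: "\<eta> > 0"
  shows "\<exists>(a::real) d (U :: 'n \<Rightarrow> (nat \<Rightarrow> 'q) set). 0 < a \<and> exact_spaces P d U \<and>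
    (\<forall>f\<in>srcs P \<union> lnks P. \<bar>a * vs.dim (U f) - h {f}\<bar> < \<eta>)"
proof -
  let ?F = "srcs P \<union> nods P"
  have "\<exists>C\<ge>0. \<forall>d (U :: 'n \<Rightarrow> (nat \<Rightarrow> 'q::{field,finite}) set) \<epsilon>. approx_spaces P d U \<epsilon> \<longrightarrow> 0 \<le> \<epsilon> \<longrightarrow>
    (\<exists>U' :: 'n \<Rightarrow> (nat \<Rightarrow> 'q) set. exact_spaces P d U' \<and>
      (\<forall>f\<in>srcs P \<union> lnks P. \<bar>real (vs.dim (U f)) - vs.dim (U' f)\<bar> \<le> C * \<epsilon>))"
    using exact_refinement[OF P O1] .
  then obtain C where C0: "0 \<le> C" and C: "\<And>d (U :: 'n \<Rightarrow> (nat \<Rightarrow> 'q::{field,finite}) set) \<epsilon>.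
    approx_spaces P d U \<epsilon> \<Longrightarrow> 0 \<le> \<epsilon> \<Longrightarrow> \<exists>U' :: 'n \<Rightarrow> (nat \<Rightarrow> 'q) set. exact_spaces P d U' \<and>
      (\<forall>f\<in>srcs P \<union> lnks P. \<bar>real (vs.dim (U f)) - vs.dim (U' f)\<bar> \<le> C * \<epsilon>)"
    by (elim exE conjE) simp
  \<comment> \<open>Constraints are checked by replacing values of \<open>h\<close> by dimensions,
    each at an error of at most \<open>c * \<delta>\<close>: \<open>C_I\<close> involves one value
    per source and key and a joint one, \<open>C_S\<close> three values, the others two. So
    \<open>m\<close> errors cover every case.\<close>
  define m where "m = real (card ?F) + 3"
  have m: "m \<ge> 3" by (simp add: m_def)
  \<comment> \<open>The final error is \<delta> for the approximation and
    \<open>C * m * \<delta>\<close> for the repair; together they make \<eta>.\<close>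
  define \<delta> where "\<delta> = \<eta> / (1 + C * m)"
  have pos: "1 + C * m > 0" using C0 m by (simp add: add_pos_nonneg)
  have \<delta>: "\<delta> > 0" "(1 + C * m) * \<delta> = \<eta>" using \<eta> pos by (auto simp: \<delta>_def)
  obtain g where g: "\<And>k. weakly_q_representable TYPE('q) (idx P) (g k)"
      "\<And>\<alpha>. \<alpha> \<subseteq> idx P \<Longrightarrow> (\<lambda>k. g k \<alpha>) \<longlonglongrightarrow> h \<alpha>"
    using h unfolding Ups_bar_def almost_q_representable_def by auto
  \<comment> \<open>Only finitely many sets are involved, so one \<open>k\<close> is close on all of
    them.\<close>
  have "eventually (\<lambda>k. \<forall>\<alpha>\<in>Pow (idx P). \<bar>g k \<alpha> - h \<alpha>\<bar> < \<delta>) sequentially"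
  proof (rule eventually_ball_finite)
    show "finite (Pow (idx P))" using problem_subsets(3)[OF P] by simp
    show "\<forall>\<alpha>\<in>Pow (idx P). eventually (\<lambda>k. \<bar>g k \<alpha> - h \<alpha>\<bar> < \<delta>) sequentially"
      using g(2) \<delta>(1) by (auto simp: tendsto_iff dist_real_def)
  qed
  then obtain k where k: "\<And>\<alpha>. \<alpha> \<subseteq> idx P \<Longrightarrow> \<bar>g k \<alpha> - h \<alpha>\<bar> < \<delta>"
    by (auto simp: eventually_sequentially)
  obtain c where c: "c > 0" "q_representable TYPE('q) (idx P) (\<lambda>\<alpha>. c * g k \<alpha>)"
    using g(1)[of k] unfolding weakly_q_representable_def by blast
  obtain d and U :: "'n \<Rightarrow> (nat \<Rightarrow> 'q) set" where
    "\<forall>f\<in>idx P. vs.subspace (U f) \<and> U f \<subseteq> fvec d"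
    "\<forall>\<alpha>\<subseteq>idx P. c * g k \<alpha> = real (vs.dim (ssum U \<alpha>))"
    using c(2) unfolding q_representable_def fvec_def ssum_def by (elim exE conjE)
  then have U: "\<And>f. f \<in> idx P \<Longrightarrow> vs.subspace (U f) \<and> U f \<subseteq> fvec d"
    and dim: "\<And>\<alpha>. \<alpha> \<subseteq> idx P \<Longrightarrow> real (vs.dim (ssum U \<alpha>)) = c * g k \<alpha>"
    by simp_all
  have near: "\<bar>real (vs.dim (ssum U \<alpha>)) - c * h \<alpha>\<bar> \<le> c * \<delta>" if "\<alpha> \<subseteq> idx P" for \<alpha>
  proof -
    have "real (vs.dim (ssum U \<alpha>)) - c * h \<alpha> = c * (g k \<alpha> - h \<alpha>)" using dim[OF that] by (simp add: algebra_simps)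
    then have "\<bar>real (vs.dim (ssum U \<alpha>)) - c * h \<alpha>\<bar> = c * \<bar>g k \<alpha> - h \<alpha>\<bar>" using c(1) by (simp add: abs_mult)
    then show ?thesis using k[OF that] c(1) by simp
  qed
  have near1: "\<bar>real (vs.dim (U f)) - c * h {f}\<bar> \<le> c * \<delta>" if "f \<in> idx P" for f
    using near[of "{f}"] that ssum_singleton[of U f] U[OF that] by simp
  define \<epsilon> where "\<epsilon> = c * (m * \<delta>)"
  have \<epsilon>0: "0 \<le> \<epsilon>" using c(1) m \<delta>(1) by (simp add: \<epsilon>_def)
  have "3 * (c * \<delta>) \<le> m * (c * \<delta>)" using m c(1) \<delta>(1) by (intro mult_right_mono) auto
  then have \<epsilon>3: "3 * (c * \<delta>) \<le> \<epsilon>" by (simp add: \<epsilon>_def algebra_simps)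
  have c\<delta>: "0 \<le> c * \<delta>" using c(1) \<delta>(1) by simp
  have tail: "real (vs.dim (ssum U (\<alpha> \<union> \<beta>))) - vs.dim (ssum U \<beta>) \<le> \<epsilon>"
    if "\<alpha> \<subseteq> idx P" "\<beta> \<subseteq> idx P" "condh h \<alpha> \<beta> = 0" for \<alpha> \<beta>
  proof -
    have "h (\<alpha> \<union> \<beta>) = h \<beta>" using that(3) by (simp add: condh_def)
    then have "\<bar>real (vs.dim (ssum U (\<alpha> \<union> \<beta>))) - c * h \<beta>\<bar> \<le> c * \<delta>" using near[of "\<alpha> \<union> \<beta>"] that by simp
    then show ?thesis using near[of \<beta>] that(2) \<epsilon>3 c\<delta> by linarith
  qed
  have "approx_spaces P d U \<epsilon>" unfolding approx_spaces_def
  proof (intro conjI ballI)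
    show "vs.subspace (U f)" "U f \<subseteq> fvec d" if "f \<in> idx P" for f using U[OF that] by auto
    have "(\<Sum>f\<in>?F. real (vs.dim (U f))) \<le> (\<Sum>f\<in>?F. c * h {f} + c * \<delta>)"
    proof (rule sum_mono)
      fix f assume "f \<in> ?F"
      then show "real (vs.dim (U f)) \<le> c * h {f} + c * \<delta>" using near1[of f] by (auto simp: idx_def)
    qed
    also have "\<dots> = c * (\<Sum>f\<in>?F. h {f}) + card ?F * (c * \<delta>)"
      by (simp add: sum.distrib sum_distrib_left)
    also have "(\<Sum>f\<in>?F. h {f}) = (\<Sum>s\<in>srcs P. h {s}) + (\<Sum>u\<in>nods P. h {u})"
      using P by (intro sum.union_disjoint) (auto simp: sec_problem_def)
    also have "\<dots> = h ?F" using h by (simp add: C_I_def)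
    finally have "(\<Sum>f\<in>?F. real (vs.dim (U f))) \<le> c * h ?F + card ?F * (c * \<delta>)" .
    moreover have "\<bar>real (vs.dim (ssum U ?F)) - c * h ?F\<bar> \<le> c * \<delta>" by (rule near) (auto simp: idx_def)
    moreover have "card ?F * (c * \<delta>) + 3 * (c * \<delta>) = \<epsilon>" by (simp add: \<epsilon>_def m_def algebra_simps)
    ultimately show "(\<Sum>f\<in>?F. real (vs.dim (U f))) - vs.dim (ssum U ?F) \<le> \<epsilon>" using c\<delta> by linarith
  next
    fix e assume e: "e \<in> lnks P"
    show "real (vs.dim (ssum U ({e} \<union> (in_edge P e \<union> {tl P e})))) - vs.dim (ssum U (in_edge P e \<union> {tl P e})) \<le> \<epsilon>"
    proof (rule tail)
      show "{e} \<subseteq> idx P" using e by (simp add: idx_def)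
      show "in_edge P e \<union> {tl P e} \<subseteq> idx P" using problem_subsets(1)[OF P e] .
      show "condh h {e} (in_edge P e \<union> {tl P e}) = 0" using h e by (simp add: C_T_def)
    qed
  next
    fix s u assume s: "s \<in> srcs P" "u \<in> dest P s"
    show "real (vs.dim (ssum U ({s} \<union> in_node P u))) - vs.dim (ssum U (in_node P u)) \<le> \<epsilon>"
    proof (rule tail)
      show "{s} \<subseteq> idx P" using s by (simp add: idx_def)
      show "in_node P u \<subseteq> idx P" using problem_subsets(2)[OF P] .
      show "condh h {s} (in_node P u) = 0" using h s by (simp add: C_D_def)
    qed
  next
    fix r assume r: "r \<in> wtap P"
    obtain A B where AB: "r = (A, B)" by (cases r)
    have i: "A \<subseteq> idx P" "B \<subseteq> idx P" using P r AB by (auto simp: sec_problem_def idx_def)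
    have "h A + h B = h (A \<union> B)" using h r AB by (auto simp: C_S_def meeth_def)
    then have "c * h A + c * h B = c * h (A \<union> B)" by (metis distrib_left)
    then have "real (vs.dim (ssum U A)) + vs.dim (ssum U B) - vs.dim (ssum U (A \<union> B)) \<le> \<epsilon>"
      using near[OF i(1)] near[OF i(2)] near[of "A \<union> B"] i \<epsilon>3 by (auto simp: abs_le_iff)
    then show "case r of (A, B) \<Rightarrow> real (vs.dim (ssum U A)) + vs.dim (ssum U B) - vs.dim (ssum U (A \<union> B)) \<le> \<epsilon>"
      using AB by simp
  qed
  then obtain U' :: "'n \<Rightarrow> (nat \<Rightarrow> 'q) set" where U': "exact_spaces P d U'"
    "\<And>f. f \<in> srcs P \<union> lnks P \<Longrightarrow> \<bar>real (vs.dim (U f)) - vs.dim (U' f)\<bar> \<le> C * \<epsilon>"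
    using C[OF _ \<epsilon>0] by metis
  have "\<bar>(1 / c) * vs.dim (U' f) - h {f}\<bar> < \<eta>" if f: "f \<in> srcs P \<union> lnks P" for f
  proof -
    have fi: "f \<in> idx P" using f by (auto simp: idx_def)
    have "\<bar>g k {f} - h {f}\<bar> < \<delta>" using k fi by simp
    moreover have "real (vs.dim (U f)) = c * g k {f}"
      using dim[of "{f}"] fi ssum_singleton[of U f] U[OF fi] by simp
    then have "g k {f} - (1 / c) * vs.dim (U' f) = (real (vs.dim (U f)) - vs.dim (U' f)) / c"
      using c(1) by (simp add: field_simps)
    then have "\<bar>g k {f} - (1 / c) * vs.dim (U' f)\<bar> = \<bar>real (vs.dim (U f)) - vs.dim (U' f)\<bar> / c"
      using c(1) by simp
    moreover have "\<dots> \<le> C * \<epsilon> / c" using U'(2)[OF f] c(1) by (simp add: divide_right_mono)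
    moreover have "C * \<epsilon> / c = C * m * \<delta>" using c(1) by (simp add: \<epsilon>_def)
    moreover have "\<delta> + C * m * \<delta> = \<eta>" using \<delta>(2) by (simp add: algebra_simps)
    ultimately show ?thesis by linarith
  qed
  then show ?thesis using c(1) U'(1) by (intro exI[of _ "1 / c"] exI[of _ d] exI[of _ U']) simp
qed

text \<open>Each tuple is approximated by an exact code so closely that after scaling by
  \<open>c n\<close> the error stays below \<open>1 / (n + 1)\<close>; the limits are then the
  same.\<close>

lemma CL_imp_achievable:
  fixes P :: "'n sncp"
  assumes P: "sec_problem P" and O1: "\<forall>s\<in>srcs P. card (orig P s) = 1"
    and cl: "(lam, om) \<in> CL P (proj ` (Ups_bar TYPE('q::{field,finite}) P \<inter> C_I P \<inter> C_T P \<inter> C_D P \<inter> C_S P))"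
  shows "achievable_qlin_ss TYPE('q) P lam om"
proof -
  define lg where "lg = log 2 (real CARD('q))"
  have lg: "lg > 0" using two_le_card_field[where 'q='q] by (simp add: lg_def)
  obtain t c where "\<forall>n. t n \<in> proj ` (Ups_bar TYPE('q) P \<inter> C_I P \<inter> C_T P \<inter> C_D P \<inter> C_S P) \<and> c n > 0"
    "\<forall>e\<in>lnks P. \<exists>L. (\<lambda>n. c n * snd (t n) e) \<longlonglongrightarrow> L \<and> L \<le> om e"
    "\<forall>s\<in>srcs P. \<exists>L. (\<lambda>n. c n * fst (t n) s) \<longlonglongrightarrow> L \<and> L \<ge> lam s"
    using cl unfolding CL_def by (elim CollectE case_prodE Pair_inject exE conjE) simp
  then have t: "\<And>n. t n \<in> proj ` (Ups_bar TYPE('q) P \<inter> C_I P \<inter> C_T P \<inter> C_D P \<inter> C_S P)"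
    and c: "\<And>n. c n > (0::real)"
    and e: "\<And>e. e \<in> lnks P \<Longrightarrow> \<exists>L. (\<lambda>n. c n * snd (t n) e) \<longlonglongrightarrow> L \<and> L \<le> om e"
    and s: "\<And>s. s \<in> srcs P \<Longrightarrow> \<exists>L. (\<lambda>n. c n * fst (t n) s) \<longlonglongrightarrow> L \<and> L \<ge> lam s"
    by simp_all
  define ok where "ok n Pr a \<longleftrightarrow> q_linear_code TYPE('q) P Pr \<and> (0::real) < a \<and>
    (\<forall>s\<in>srcs P. \<forall>u\<in>dest P s. condh (ent_fun Pr) {s} (in_node P u) = 0) \<and>
    (\<forall>(A,B)\<in>wtap P. meeth (ent_fun Pr) A B = 0) \<and>
    (\<forall>f\<in>lnks P. \<bar>c n * a * log 2 (supp_size Pr f) - c n * snd (t n) f\<bar> < inverse (real (Suc n))) \<and>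
    (\<forall>f\<in>srcs P. \<bar>c n * a * log 2 (supp_size Pr f) - c n * fst (t n) f\<bar> < inverse (real (Suc n)))" for n Pr a
  have "\<exists>Pr a. ok n Pr a" for n
  proof -
    obtain h where h: "h \<in> Ups_bar TYPE('q) P \<inter> C_I P \<inter> C_T P \<inter> C_D P \<inter> C_S P" "t n = proj h" using t[of n] by (elim imageE)
    \<comment> \<open>The factor \<open>c n\<close> is cancelled in advance, since the sequence
      \<open>c\<close> may be unbounded.\<close>
    define \<eta> where "\<eta> = inverse (real (Suc n)) / c n"
    have \<eta>: "\<eta> > 0" using c[of n] by (simp add: \<eta>_def)
    obtain a :: real and d and U :: "'n \<Rightarrow> (nat \<Rightarrow> 'q) set" where a: "0 < a" "exact_spaces P d U"
      "\<forall>f\<in>srcs P \<union> lnks P. \<bar>a * vs.dim (U f) - h {f}\<bar> < \<eta>"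
      using almost_representable_exact[OF P O1 h(1) \<eta>] by (elim exE conjE)
    obtain Pr where Pr: "q_linear_code TYPE('q) P Pr"
      "\<forall>s\<in>srcs P. \<forall>u\<in>dest P s. condh (ent_fun Pr) {s} (in_node P u) = 0"
      "\<forall>(A,B)\<in>wtap P. meeth (ent_fun Pr) A B = 0"
      "\<forall>f\<in>idx P. log 2 (supp_size Pr f) = log 2 CARD('q) * vs.dim (U f)"
      using exact_spaces_code[OF P a(2)] by (elim exE conjE)
    \<comment> \<open>Dividing \<open>a\<close> by \<open>lg\<close> converts bits back to
      dimensions.\<close>
    have near: "\<bar>c n * (a / lg) * log 2 (supp_size Pr f) - c n * h {f}\<bar> < inverse (real (Suc n))"
      if f: "f \<in> srcs P \<union> lnks P" for f
    proof -
      have "log 2 (supp_size Pr f) = lg * vs.dim (U f)" using Pr(4) f by (auto simp: idx_def lg_def)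
      then have "c n * (a / lg) * log 2 (supp_size Pr f) - c n * h {f} = c n * (a * vs.dim (U f) - h {f})"
        using lg by (simp add: field_simps)
      then have "\<bar>c n * (a / lg) * log 2 (supp_size Pr f) - c n * h {f}\<bar> = c n * \<bar>a * vs.dim (U f) - h {f}\<bar>"
        using c[of n] by (simp add: abs_mult)
      also have "\<dots> < c n * \<eta>" using a(3) f c[of n] by (intro mult_strict_left_mono) auto
      also have "\<dots> = inverse (real (Suc n))" using c[of n] by (simp add: \<eta>_def)
      finally show ?thesis .
    qed
    show ?thesis unfolding ok_def
      using Pr(1-3) a(1) lg near h(2) by (intro exI[of _ Pr] exI[of _ "a / lg"]) (simp add: proj_def)
  qed
  then obtain Y a where "\<And>n. ok n (Y n) (a n)" by metis
  then have Y: "\<And>n. q_linear_code TYPE('q) P (Y n)" "\<And>n. (0::real) < a n"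
    "\<And>n. \<forall>s\<in>srcs P. \<forall>u\<in>dest P s. condh (ent_fun (Y n)) {s} (in_node P u) = 0"
    "\<And>n. \<forall>(A,B)\<in>wtap P. meeth (ent_fun (Y n)) A B = 0"
    "\<And>n. \<forall>f\<in>lnks P. \<bar>c n * a n * log 2 (supp_size (Y n) f) - c n * snd (t n) f\<bar> < inverse (real (Suc n))"
    "\<And>n. \<forall>f\<in>srcs P. \<bar>c n * a n * log 2 (supp_size (Y n) f) - c n * fst (t n) f\<bar> < inverse (real (Suc n))"
    unfolding ok_def by simp_all
  have lim: "u \<longlonglongrightarrow> L" if "v \<longlonglongrightarrow> L" "\<And>n. \<bar>u n - v n\<bar> < inverse (real (Suc n))" for u v :: "nat \<Rightarrow> real" and L
  proof -
    have "(\<lambda>n. u n - v n) \<longlonglongrightarrow> 0"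
      by (rule Lim_null_comparison[OF _ LIMSEQ_inverse_real_of_nat]) (use that(2) in \<open>auto intro!: always_eventually intro: less_imp_le\<close>)
    from tendsto_add[OF this that(1)] show ?thesis by simp
  qed
  have "\<exists>L. (\<lambda>n. c n * a n * log 2 (supp_size (Y n) f)) \<longlonglongrightarrow> L \<and> L \<le> om f" if f: "f \<in> lnks P" for f
  proof -
    obtain L where L: "(\<lambda>n. c n * snd (t n) f) \<longlonglongrightarrow> L" "L \<le> om f" using e[OF f] by blast
    have "(\<lambda>n. c n * a n * log 2 (supp_size (Y n) f)) \<longlonglongrightarrow> L"
      using Y(5) f by (intro lim[OF L(1)]) blast
    then show ?thesis using L(2) by blast
  qed
  moreover have "\<exists>L. (\<lambda>n. c n * a n * log 2 (supp_size (Y n) f)) \<longlonglongrightarrow> L \<and> L \<ge> lam f" if f: "f \<in> srcs P" for f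
  proof -
    obtain L where L: "(\<lambda>n. c n * fst (t n) f) \<longlonglongrightarrow> L" "L \<ge> lam f" using s[OF f] by blast
    have "(\<lambda>n. c n * a n * log 2 (supp_size (Y n) f)) \<longlonglongrightarrow> L"
      using Y(6) f by (intro lim[OF L(1)]) blast
    then show ?thesis using L(2) by blast
  qed
  ultimately show ?thesis unfolding achievable_qlin_ss_def using Y(1-4) c
    by (intro exI[of _ Y] exI[of _ "\<lambda>n. c n * a n"]) simp
qed

theorem theorem9:
  fixes P :: "'n sncp" and lam om :: "'n \<Rightarrow> real"
  assumes "sec_problem P"
    and "\<forall>s\<in>srcs P. card (orig P s) = 1"
    and "\<forall>s\<in>srcs P. lam s \<ge> 0" and "\<forall>e\<in>lnks P. om e \<ge> 0"
  shows "achievable_qlin_ss TYPE('q::{field,finite}) P lam om \<longleftrightarrow>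
    (lam, om) \<in> CL P (proj ` (Ups_bar TYPE('q) P \<inter> C_I P \<inter> C_T P \<inter> C_D P \<inter> C_S P))"
  using achievable_imp_CL[OF assms(1)] CL_imp_achievable[OF assms(1,2)] by (rule iffI)

end
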